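(* Let $k,n,m\geq 2$ be integers with $n<m$ and $n,m$ coprime, and let $c=(x_1x_2\cdots x_n)^m\in W(k,n,m)$. Then the group $W(k,n,m)$ is a central extension of $W_{k,n,m}^+$ by the subgroup $\langle c\rangle$; that is, $\langle c \rangle$ is central in $W(k,n,m)$ and there is a short exact sequence $$1\longrightarrow\langle c\rangle\longrightarrow W(k,n,m)\longrightarrow W_{k,n,m}^+\longrightarrow 1,$$ where the first map is the inclusion.
   Context: Toric reflection group: $W(k,n,m)$ is the group with generators $x_1,\dots,x_n$ and relations $x_i^k=1$ for $i=1,\dots,n$, and $x_1x_2\cdots x_m=x_ix_{i+1}\cdots x_{i+m-1}$ for $i=2,\dots,n$, indices of the $x_j$ being taken modulo $n$. $W_{k,n,m}$ is the Coxeter group $\langle r_1,r_2,r_3\mid r_1^2=r_2^2=r_3^2=1,\ (r_1r_2)^k=(r_2r_3)^n=(r_3r_1)^m=1\rangle$ of rank three, and $W_{k,n,m}^+$ is its alternating subgroup, i.e., the index-two subgroup of elements of even length with respect to $\{r_1,r_2,r_3\}$. *)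

theory Defs
  imports "HOL-Algebra.Algebra"
begin

section \<open>Groups given by generators and relations\<close>

text \<open>The letter \<open>(x, True)\<close> stands for the generator \<open>x\<close>, and \<open>(x, False)\<close> for its
  formal inverse. A relation \<open>u = v\<close> is a pair \<open>(u, v)\<close> of words.\<close>

type_synonym 'a sword = "('a \<times> bool) list"

abbreviation swords :: "'a set \<Rightarrow> 'a sword set" where
  "swords S \<equiv> lists (S \<times> UNIV)"

inductive_set pres_cong :: "'a set \<Rightarrow> ('a sword \<times> 'a sword) set \<Rightarrow> ('a sword \<times> 'a sword) set"
  for S :: "'a set" and R :: "('a sword \<times> 'a sword) set" where
  refl: "u \<in> swords S \<Longrightarrow> (u, u) \<in> pres_cong S R"
| sym: "(u, v) \<in> pres_cong S R \<Longrightarrow> (v, u) \<in> pres_cong S R"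
| trans: "(u, v) \<in> pres_cong S R \<Longrightarrow> (v, w) \<in> pres_cong S R \<Longrightarrow> (u, w) \<in> pres_cong S R"
| append: "(u, u') \<in> pres_cong S R \<Longrightarrow> (v, v') \<in> pres_cong S R \<Longrightarrow> (u @ v, u' @ v') \<in> pres_cong S R"
| cancel: "x \<in> S \<Longrightarrow> ([(x, b), (x, \<not> b)], []) \<in> pres_cong S R"
| rel: "(u, v) \<in> R \<Longrightarrow> u \<in> swords S \<Longrightarrow> v \<in> swords S \<Longrightarrow> (u, v) \<in> pres_cong S R"

definition pres_class :: "'a set \<Rightarrow> ('a sword \<times> 'a sword) set \<Rightarrow> 'a sword \<Rightarrow> 'a sword set" where
  "pres_class S R w = pres_cong S R `` {w}"

text \<open>The product of two classes is formed as a union over all pairs of representatives;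
  all of these give the same class, see \<open>pres_class_mult\<close> below.\<close>

definition presented_group :: "'a set \<Rightarrow> ('a sword \<times> 'a sword) set \<Rightarrow> 'a sword set monoid" where
  "presented_group S R =
    \<lparr>carrier = swords S // pres_cong S R,
     monoid.mult = (\<lambda>A B. \<Union>u\<in>A. \<Union>v\<in>B. pres_class S R (u @ v)),
     one = pres_class S R []\<rparr>"

lemma pres_cong_swords: "(u, v) \<in> pres_cong S R \<Longrightarrow> u \<in> swords S \<and> v \<in> swords S"
  by (induction rule: pres_cong.induct) auto

lemma equiv_pres_cong: "equiv (swords S) (pres_cong S R)"
proof (rule equivI)
  show "pres_cong S R \<subseteq> swords S \<times> swords S"
    by (auto dest: pres_cong_swords)
  show "refl_on (swords S) (pres_cong S R)"
    using pres_cong.refl by (auto simp: refl_on_def)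
  show "sym_on UNIV (pres_cong S R)"
    by (meson pres_cong.sym symI)
  show "trans_on UNIV (pres_cong S R)"
    by (meson pres_cong.trans transI)
qed

lemma pres_class_eq_iff:
  assumes "u \<in> swords S" "v \<in> swords S"
  shows "pres_class S R u = pres_class S R v \<longleftrightarrow> (u, v) \<in> pres_cong S R"
  using assms eq_equiv_class_iff[OF equiv_pres_cong] by (simp add: pres_class_def)

lemma carrier_presented_group: "carrier (presented_group S R) = pres_class S R ` swords S"
  by (auto simp: presented_group_def pres_class_def quotient_def)

lemma one_presented_group: "\<one>\<^bsub>presented_group S R\<^esub> = pres_class S R []"
  by (simp add: presented_group_def)

lemma pres_class_mult:
  assumes "u \<in> swords S" "v \<in> swords S"
  shows "pres_class S R u \<otimes>\<^bsub>presented_group S R\<^esub> pres_class S R v = pres_class S R (u @ v)"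
proof -
  have "pres_class S R (u' @ v') = pres_class S R (u @ v)"
    if "u' \<in> pres_class S R u" "v' \<in> pres_class S R v" for u' v'
  proof -
    have "(u @ v, u' @ v') \<in> pres_cong S R"
      using that by (auto simp: pres_class_def intro: pres_cong.append)
    then have "(u' @ v', u @ v) \<in> pres_cong S R" by (rule pres_cong.sym)
    moreover from this have "u' @ v' \<in> swords S" "u @ v \<in> swords S"
      using pres_cong_swords by blast+
    ultimately show ?thesis
      using pres_class_eq_iff by blast
  qed
  moreover have "u \<in> pres_class S R u" "v \<in> pres_class S R v"
    using assms by (auto simp: pres_class_def intro: pres_cong.refl)
  ultimately have "(\<Union>u'\<in>pres_class S R u. \<Union>v'\<in>pres_class S R v. pres_class S R (u' @ v'))
      = pres_class S R (u @ v)"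
    by blast
  then show ?thesis by (simp add: presented_group_def)
qed

lemma pres_cong_inverse:
  "u \<in> swords S \<Longrightarrow> (map (\<lambda>(x, b). (x, \<not> b)) (rev u) @ u, []) \<in> pres_cong S R"
proof (induction u)
  case Nil
  then show ?case by (simp add: pres_cong.refl)
next
  case (Cons a u)
  obtain x b where a: "a = (x, b)" by (cases a)
  let ?i = "map (\<lambda>(x, b). (x, \<not> b)) (rev u)"
  have x: "x \<in> S" and u: "u \<in> swords S" and i: "?i \<in> swords S"
    using Cons.prems a by auto
  have "([(x, \<not> b), (x, b)], []) \<in> pres_cong S R"
    using pres_cong.cancel[OF x, of "\<not> b"] by simp
  from pres_cong.append[OF pres_cong.refl[OF i] pres_cong.append[OF this pres_cong.refl[OF u]]]
  have "(?i @ [(x, \<not> b), (x, b)] @ u, ?i @ u) \<in> pres_cong S R" by simp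
  with Cons.IH[OF u] show ?case
    using a by (auto intro: pres_cong.trans)
qed

lemma group_presented_group: "group (presented_group S R)"
proof (rule groupI)
  fix A B C
  assume "A \<in> carrier (presented_group S R)" "B \<in> carrier (presented_group S R)"
  then obtain u v where uv: "A = pres_class S R u" "B = pres_class S R v"
      "u \<in> swords S" "v \<in> swords S"
    by (auto simp: carrier_presented_group)
  then show "A \<otimes>\<^bsub>presented_group S R\<^esub> B \<in> carrier (presented_group S R)"
    by (auto simp: pres_class_mult carrier_presented_group)
  assume "C \<in> carrier (presented_group S R)"
  then obtain w where "C = pres_class S R w" "w \<in> swords S"
    by (auto simp: carrier_presented_group)
  with uv show "A \<otimes>\<^bsub>presented_group S R\<^esub> B \<otimes>\<^bsub>presented_group S R\<^esub> C
      = A \<otimes>\<^bsub>presented_group S R\<^esub> (B \<otimes>\<^bsub>presented_group S R\<^esub> C)"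
    using pres_class_mult[of "u @ v" S w R] pres_class_mult[of u S "v @ w" R]
    by (simp add: pres_class_mult)
next
  show "\<one>\<^bsub>presented_group S R\<^esub> \<in> carrier (presented_group S R)"
    by (auto simp: carrier_presented_group one_presented_group)
next
  fix A assume "A \<in> carrier (presented_group S R)"
  then obtain u where u: "A = pres_class S R u" "u \<in> swords S"
    by (auto simp: carrier_presented_group)
  show "\<one>\<^bsub>presented_group S R\<^esub> \<otimes>\<^bsub>presented_group S R\<^esub> A = A"
    using u pres_class_mult[of "[]" S u R] by (simp add: one_presented_group)
  let ?i = "map (\<lambda>(x, b). (x, \<not> b)) (rev u)"
  have i: "?i \<in> swords S" using u by auto
  have "pres_class S R ?i \<otimes>\<^bsub>presented_group S R\<^esub> A = \<one>\<^bsub>presented_group S R\<^esub>"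
    using u i pres_cong_inverse[OF u(2), of R] pres_class_eq_iff[of "?i @ u" S "[]" R]
    by (simp add: pres_class_mult one_presented_group)
  then show "\<exists>B\<in>carrier (presented_group S R). B \<otimes>\<^bsub>presented_group S R\<^esub> A = \<one>\<^bsub>presented_group S R\<^esub>"
    using i by (auto simp: carrier_presented_group)
qed


section \<open>Toric reflection groups\<close>

text \<open>\<open>toric_index n j\<close> is the representative of \<open>j\<close> modulo \<open>n\<close> in \<open>{1..n}\<close>, and
  \<open>toric_word n i l\<close> is the word \<open>x\<^sub>i x\<^sub>i\<^sub>+\<^sub>1 \<dots> x\<^sub>i\<^sub>+\<^sub>l\<^sub>-\<^sub>1\<close>
  with indices taken modulo \<open>n\<close>.\<close>

definition toric_index :: "nat \<Rightarrow> nat \<Rightarrow> nat" where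
  "toric_index n j = (j - 1) mod n + 1"

definition toric_word :: "nat \<Rightarrow> nat \<Rightarrow> nat \<Rightarrow> nat sword" where
  "toric_word n i l = map (\<lambda>j. (toric_index n j, True)) [i..<i + l]"

definition toric_rels :: "nat \<Rightarrow> nat \<Rightarrow> nat \<Rightarrow> (nat sword \<times> nat sword) set" where
  "toric_rels k n m =
    {(replicate k (i, True), []) | i. i \<in> {1..n}} \<union>
    {(toric_word n 1 m, toric_word n i m) | i. i \<in> {2..n}}"

definition toric_group :: "nat \<Rightarrow> nat \<Rightarrow> nat \<Rightarrow> nat sword set monoid" where
  "toric_group k n m = presented_group {1..n} (toric_rels k n m)"

definition toric_c :: "nat \<Rightarrow> nat \<Rightarrow> nat \<Rightarrow> nat sword set" where
  "toric_c k n m =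
    pres_class {1..n} (toric_rels k n m) (toric_word n 1 n) [^]\<^bsub>toric_group k n m\<^esub> m"


section \<open>Rank-three Coxeter groups and their alternating subgroups\<close>

definition coxeter_rels :: "nat \<Rightarrow> nat \<Rightarrow> nat \<Rightarrow> (nat sword \<times> nat sword) set" where
  "coxeter_rels k n m =
    {([(i, True), (i, True)], []) | i. i \<in> {1, 2, 3}} \<union>
    {(concat (replicate k [(1, True), (2, True)]), []),
     (concat (replicate n [(2, True), (3, True)]), []),
     (concat (replicate m [(3, True), (1, True)]), [])}"

definition coxeter_group :: "nat \<Rightarrow> nat \<Rightarrow> nat \<Rightarrow> nat sword set monoid" where
  "coxeter_group k n m = presented_group {1, 2, 3} (coxeter_rels k n m)"

definition coxeter_gens :: "nat \<Rightarrow> nat \<Rightarrow> nat \<Rightarrow> nat sword set set" where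
  "coxeter_gens k n m = (\<lambda>i. pres_class {1, 2, 3} (coxeter_rels k n m) [(i, True)]) ` {1, 2, 3}"

text \<open>Inverses of elements of \<open>S\<close> are not allowed as factors; this agrees with the usual word
  length because the Coxeter generators are involutions.\<close>

definition word_length :: "('a, 'b) monoid_scheme \<Rightarrow> 'a set \<Rightarrow> 'a \<Rightarrow> nat" where
  "word_length G S g =
    (LEAST l. \<exists>ss. set ss \<subseteq> S \<and> length ss = l \<and> foldr (\<otimes>\<^bsub>G\<^esub>) ss \<one>\<^bsub>G\<^esub> = g)"

definition alternating_set :: "nat \<Rightarrow> nat \<Rightarrow> nat \<Rightarrow> nat sword set set" where
  "alternating_set k n m =
    {w \<in> carrier (coxeter_group k n m).
      even (word_length (coxeter_group k n m) (coxeter_gens k n m) w)}"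

definition alternating_group :: "nat \<Rightarrow> nat \<Rightarrow> nat \<Rightarrow> nat sword set monoid" where
  "alternating_group k n m = (coxeter_group k n m)\<lparr>carrier := alternating_set k n m\<rparr>"

text \<open>The even elements do form a subgroup of index two.\<close>

lemma coxeter_cong_parity:
  "(u, v) \<in> pres_cong {1, 2, 3} (coxeter_rels k n m) \<Longrightarrow> even (length u) = even (length v)"
proof (induction rule: pres_cong.induct)
  case (rel u v)
  then show ?case
    by (auto simp: coxeter_rels_def length_concat sum_list_replicate)
qed auto

lemma coxeter_product:
  assumes "set is \<subseteq> {1, 2, 3}"
  shows "foldr (\<otimes>\<^bsub>coxeter_group k n m\<^esub>)
      (map (\<lambda>i. pres_class {1, 2, 3} (coxeter_rels k n m) [(i, True)]) is) \<one>\<^bsub>coxeter_group k n m\<^esub>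
    = pres_class {1, 2, 3} (coxeter_rels k n m) (map (\<lambda>i. (i, True)) is)"
  using assms
proof (induction "is")
  case Nil
  then show ?case by (simp add: coxeter_group_def one_presented_group)
next
  case (Cons i "is")
  then have "[(i, True)] \<in> swords {1, 2, 3}" "map (\<lambda>i. (i, True)) is \<in> swords {1, 2, 3}"
    by auto
  from pres_class_mult[OF this] Cons show ?case
    by (simp add: coxeter_group_def)
qed

lemma coxeter_positive_word:
  "u \<in> swords {1, 2, 3} \<Longrightarrow>
    (u, map (\<lambda>i. (i, True)) (map fst u)) \<in> pres_cong {1, 2, 3} (coxeter_rels k n m)"
proof (induction u)
  case Nil
  then show ?case by (simp add: pres_cong.refl)
next
  case (Cons a u)
  let ?C = "pres_cong {1, 2, 3} (coxeter_rels k n m)"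
  obtain i b where a: "a = (i, b)" by (cases a)
  have i: "i \<in> {1, 2, 3}" using Cons.prems a by auto
  have rfl: "([(i, c)], [(i, c)]) \<in> ?C" for c
    using i by (intro pres_cong.refl) auto
  have "([(i, False)], [(i, True)]) \<in> ?C"
  proof -
    have "([(i, True), (i, True)], []) \<in> ?C"
      using i by (intro pres_cong.rel) (auto simp: coxeter_rels_def)
    from pres_cong.append[OF rfl[of False] this]
    have "([(i, False), (i, True), (i, True)], [(i, False)]) \<in> ?C" by simp
    moreover have "([(i, False), (i, True), (i, True)], [(i, True)]) \<in> ?C"
      using pres_cong.append[OF pres_cong.cancel[OF i, of False] rfl[of True]] by simp
    ultimately show ?thesis by (meson pres_cong.sym pres_cong.trans)
  qed
  with rfl[of True] have "([a], [(i, True)]) \<in> ?C"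
    using a by (cases b) auto
  moreover have "(u, map (\<lambda>i. (i, True)) (map fst u)) \<in> ?C"
    using Cons by auto
  ultimately have "([a] @ u, [(i, True)] @ map (\<lambda>i. (i, True)) (map fst u)) \<in> ?C"
    by (rule pres_cong.append)
  then show ?case using a by simp
qed

lemma even_word_length_coxeter:
  assumes u: "u \<in> swords {1, 2, 3}"
  shows "even (word_length (coxeter_group k n m) (coxeter_gens k n m)
      (pres_class {1, 2, 3} (coxeter_rels k n m) u)) \<longleftrightarrow> even (length u)"
proof -
  let ?G = "coxeter_group k n m"
  let ?cl = "pres_class {1, 2, 3} (coxeter_rels k n m)"
  let ?g = "\<lambda>i. ?cl [(i, True)]"
  let ?P = "\<lambda>l. \<exists>ss. set ss \<subseteq> coxeter_gens k n m \<and> length ss = l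
      \<and> foldr (\<otimes>\<^bsub>?G\<^esub>) ss \<one>\<^bsub>?G\<^esub> = ?cl u"
  have pu: "map (\<lambda>i. (i, True)) (map fst u) \<in> swords {1, 2, 3}" "set (map fst u) \<subseteq> {1, 2, 3}"
    using u by fastforce+
  have "?P (length u)"
  proof (intro exI conjI)
    show "set (map ?g (map fst u)) \<subseteq> coxeter_gens k n m"
      unfolding coxeter_gens_def set_map[of ?g] using pu(2) by (rule image_mono)
    show "foldr (\<otimes>\<^bsub>?G\<^esub>) (map ?g (map fst u)) \<one>\<^bsub>?G\<^esub> = ?cl u"
      using coxeter_product[OF pu(2)] coxeter_positive_word[OF u] pres_class_eq_iff[OF u pu(1)]
      by metis
  qed simp
  then have "?P (LEAST l. ?P l)" by (rule LeastI)
  then obtain ss where ss: "set ss \<subseteq> coxeter_gens k n m" "length ss = (LEAST l. ?P l)"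
      "foldr (\<otimes>\<^bsub>?G\<^esub>) ss \<one>\<^bsub>?G\<^esub> = ?cl u"
    by blast
  have "ss \<in> lists (?g ` {1, 2, 3})"
    using ss(1) by (auto simp: coxeter_gens_def)
  then obtain "is" where "is": "ss = map ?g is" "set is \<subseteq> {1, 2, 3}"
    unfolding lists_image by auto
  have w: "map (\<lambda>i. (i, True)) is \<in> swords {1, 2, 3}"
    using "is"(2) by auto
  have "(map (\<lambda>i. (i, True)) is, u) \<in> pres_cong {1, 2, 3} (coxeter_rels k n m)"
    using ss(3) "is" coxeter_product[OF "is"(2)] pres_class_eq_iff[OF w u] by simp
  from coxeter_cong_parity[OF this] show ?thesis
    using ss(2) "is"(1) by (simp add: word_length_def)
qed

lemma alternating_set_index_two:
  "subgroup (alternating_set k n m) (coxeter_group k n m)"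
  "card (rcosets\<^bsub>coxeter_group k n m\<^esub> (alternating_set k n m)) = 2"
proof -
  let ?G = "coxeter_group k n m"
  let ?cl = "pres_class {1, 2, 3} (coxeter_rels k n m)"
  let ?Z = "integer_mod_group 2"
  define par where "par A = (if A \<in> alternating_set k n m then 0 else 1 :: int)" for A
  have G: "group ?G" by (simp add: coxeter_group_def group_presented_group)
  have mem: "?cl u \<in> alternating_set k n m \<longleftrightarrow> even (length u)" if "u \<in> swords {1, 2, 3}" for u
    using that even_word_length_coxeter[OF that]
    by (auto simp: alternating_set_def coxeter_group_def carrier_presented_group)
  have hom: "par \<in> hom ?G ?Z"
  proof (rule homI)
    fix A B assume "A \<in> carrier ?G" "B \<in> carrier ?G"
    then obtain u v where uv: "A = ?cl u" "B = ?cl v" "u \<in> swords {1, 2, 3}" "v \<in> swords {1, 2, 3}"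
      by (auto simp: coxeter_group_def carrier_presented_group)
    then have "A \<otimes>\<^bsub>?G\<^esub> B = ?cl (u @ v)"
      by (simp add: coxeter_group_def pres_class_mult)
    moreover have "u @ v \<in> swords {1, 2, 3}" using uv by simp
    ultimately show "par (A \<otimes>\<^bsub>?G\<^esub> B) = par A \<otimes>\<^bsub>?Z\<^esub> par B"
      using mem[OF uv(3)] mem[OF uv(4)] mem[of "u @ v"]
      by (simp add: par_def uv(1,2) mult_integer_mod_group del: append_in_lists_conv One_nat_def)
  qed (simp add: par_def carrier_integer_mod_group)
  interpret group_hom ?G ?Z par
    using G hom by (simp add: group_hom_def group_hom_axioms_def)
  have ker: "kernel ?G ?Z par = alternating_set k n m"
    by (auto simp: kernel_def par_def alternating_set_def)
  show "subgroup (alternating_set k n m) ?G"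
    using subgroup_kernel ker by simp
  have "?cl [] \<in> carrier ?G" "?cl [(1, True)] \<in> carrier ?G"
    by (auto simp: coxeter_group_def carrier_presented_group)
  moreover have "par (?cl []) = 0" "par (?cl [(1, True)]) = 1"
    using mem[of "[]"] mem[of "[(1, True)]"] by (auto simp: par_def)
  ultimately have "{0, 1} \<subseteq> par ` carrier ?G"
    by (metis empty_subsetI image_eqI insert_subset)
  moreover have "carrier ?Z = {0, 1}"
    by (auto simp: carrier_integer_mod_group)
  ultimately have surj: "par ` carrier ?G = carrier ?Z"
    using hom_closed by auto
  have "?G Mod kernel ?G ?Z par \<cong> ?Z"
    by (rule FactGroup_iso[OF surj])
  then have "card (carrier (?G Mod kernel ?G ?Z par)) = card (carrier ?Z)"
    by (rule iso_same_card)
  also have "\<dots> = 2"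
    using \<open>carrier ?Z = {0, 1}\<close> by simp
  finally show "card (rcosets\<^bsub>?G\<^esub> (alternating_set k n m)) = 2"
    by (simp add: FactGroup_def ker)
qed

end

theory Submission
  imports Defs
begin

text \<open>
  With indices in the integers and \<open>\<delta> = x\<^sub>1 \<cdots> x\<^sub>m\<close>, the relations give
  \<open>\<delta> x\<^sub>i\<^sub>+\<^sub>m = x\<^sub>i \<delta>\<close>, so \<open>\<delta>\<^sup>n = c\<close> is central. Choose \<open>m q = n r + 1\<close> and put
  \<open>t = \<delta>\<^sup>-\<^sup>q\<close>; then \<open>x\<^sub>i\<^sub>+\<^sub>1 = t x\<^sub>i t\<^sup>-\<^sup>1\<close>, and modulo \<open>c\<close> one gets
  \<open>x\<^sub>1\<^sup>k = t\<^sup>n = (x\<^sub>1 t)\<^sup>m = 1\<close>, the relations of \<open>a = r\<^sub>1 r\<^sub>2\<close>, \<open>b = r\<^sub>2 r\<^sub>3\<close> in the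
  alternating group. The map \<open>\<pi>\<close> sends \<open>x\<^sub>i\<close> to \<open>b\<^sup>i\<^sup>-\<^sup>1 a b\<^sup>1\<^sup>-\<^sup>i\<close>.

  To see that its kernel is \<open>\<langle>c\<rangle>\<close> without a presentation of the alternating group, let
  \<open>\<theta>\<close> be the involutive automorphism \<open>x\<^sub>i \<mapsto> x\<^sub>2\<^sub>-\<^sub>i\<^sup>-\<^sup>1\<close>. The Coxeter group maps to the quotient by
  \<open>\<langle>c\<rangle>\<close> of the semidirect product of the toric group with \<open>\<langle>\<theta>\<rangle>\<close>, via
  \<open>r\<^sub>1 \<mapsto> x\<^sub>1 \<theta>\<close>, \<open>r\<^sub>2 \<mapsto> \<theta>\<close>, \<open>r\<^sub>3 \<mapsto> t\<^sup>-\<^sup>1 \<theta>\<close>, and the composite with \<open>\<pi>\<close> is the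
  canonical map on the toric group.
\<close>

section \<open>Homomorphisms out of a presented group\<close>

definition word_eval :: "('g, 'r) monoid_scheme \<Rightarrow> ('a \<Rightarrow> 'g) \<Rightarrow> 'a sword \<Rightarrow> 'g" where
  "word_eval G f w =
    foldr (\<lambda>(x, b) p. (if b then f x else inv\<^bsub>G\<^esub> f x) \<otimes>\<^bsub>G\<^esub> p) w \<one>\<^bsub>G\<^esub>"

lemma word_eval_Nil [simp]: "word_eval G f [] = \<one>\<^bsub>G\<^esub>"
  by (simp add: word_eval_def)

lemma word_eval_Cons [simp]:
  "word_eval G f ((x, b) # w) = (if b then f x else inv\<^bsub>G\<^esub> f x) \<otimes>\<^bsub>G\<^esub> word_eval G f w"
  by (simp add: word_eval_def)

context group
begin

lemma word_eval_closed [intro, simp]: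
  assumes "f \<in> S \<rightarrow> carrier G" "w \<in> swords S"
  shows "word_eval G f w \<in> carrier G"
  using assms(2)
proof (induction w)
  case (Cons a w)
  obtain x b where "a = (x, b)" by (cases a)
  with Cons assms(1) have "f x \<in> carrier G" "a = (x, b)" "word_eval G f w \<in> carrier G" by auto
  then show ?case by simp
qed simp

lemma word_eval_append:
  assumes f: "f \<in> S \<rightarrow> carrier G" and v: "v \<in> swords S" and u: "u \<in> swords S"
  shows "word_eval G f (u @ v) = word_eval G f u \<otimes> word_eval G f v"
  using u
proof (induction u)
  case (Cons a u)
  obtain x b where "a = (x, b)" by (cases a)
  with Cons f v show ?case by (auto simp: m_assoc Pi_iff)
qed (use f v in simp)

lemma word_eval_replicate:
  assumes "x \<in> S" "f \<in> S \<rightarrow> carrier G"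
  shows "word_eval G f (replicate l (x, True)) = f x [^] l"
proof -
  have "f x \<in> carrier G" using assms by auto
  then show ?thesis by (induction l) (auto simp: nat_pow_Suc2[symmetric] simp del: nat_pow_Suc Group.nat_pow_Suc)
qed

lemma word_eval_concat_replicate:
  assumes "w \<in> swords S" "f \<in> S \<rightarrow> carrier G"
  shows "word_eval G f (concat (replicate l w)) = word_eval G f w [^] l"
proof (induction l)
  case (Suc l)
  have "concat (replicate l w) \<in> swords S"
    using assms(1) by (induction l) auto
  then show ?case
    using Suc assms
    by (simp add: word_eval_append[OF assms(2) _ assms(1)] nat_pow_Suc2 word_eval_closed[OF assms(2,1)]
        del: nat_pow_Suc Group.nat_pow_Suc)
qed simp

lemma word_eval_pres_cong:
  assumes f: "f \<in> S \<rightarrow> carrier G"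
    and R: "\<And>u v. (u, v) \<in> R \<Longrightarrow> word_eval G f u = word_eval G f v"
    and uv: "(u, v) \<in> pres_cong S R"
  shows "word_eval G f u = word_eval G f v"
  using uv
proof (induction rule: pres_cong.induct)
  case (append u u' v v')
  then show ?case
    using pres_cong_swords[OF append.hyps(1)] pres_cong_swords[OF append.hyps(2)]
    by (simp add: word_eval_append[OF f])
next
  case (cancel x b)
  then have "f x \<in> carrier G" using f by auto
  then show ?case by (cases b) auto
qed (auto intro: R)

lemma presented_group_lift:
  assumes f: "f \<in> S \<rightarrow> carrier G"
    and R: "\<And>u v. (u, v) \<in> R \<Longrightarrow> word_eval G f u = word_eval G f v"
  obtains h where "h \<in> hom (presented_group S R) G"
    and "\<And>w. w \<in> swords S \<Longrightarrow> h (pres_class S R w) = word_eval G f w"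
proof -
  \<comment> \<open>A class is a set of words, so one member is chosen; congruent words have equal
    values, which makes the choice harmless.\<close>
  define h where "h A = word_eval G f (SOME w. w \<in> A)" for A
  have h: "h (pres_class S R w) = word_eval G f w" if w: "w \<in> swords S" for w
  proof -
    have "w \<in> pres_class S R w"
      using w by (simp add: pres_class_def pres_cong.refl)
    then have "(SOME w'. w' \<in> pres_class S R w) \<in> pres_class S R w" by (rule someI)
    then have "(w, SOME w'. w' \<in> pres_class S R w) \<in> pres_cong S R"
      by (simp add: pres_class_def)
    from word_eval_pres_cong[OF f R this] show ?thesis by (simp add: h_def)
  qed
  have "h \<in> hom (presented_group S R) G"
  proof (rule homI)
    fix A B
    assume "A \<in> carrier (presented_group S R)" "B \<in> carrier (presented_group S R)"
    then obtain u v where uv: "A = pres_class S R u" "B = pres_class S R v"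
        "u \<in> swords S" "v \<in> swords S"
      by (auto simp: carrier_presented_group)
    moreover have "u @ v \<in> swords S" using uv by simp
    ultimately show "h (A \<otimes>\<^bsub>presented_group S R\<^esub> B) = h A \<otimes> h B"
      by (simp add: pres_class_mult h word_eval_append[OF f] del: append_in_lists_conv)
  next
    fix A assume "A \<in> carrier (presented_group S R)"
    then show "h A \<in> carrier G"
      by (auto simp: carrier_presented_group h[unfolded in_lists_conv_set] intro!: word_eval_closed[OF f])
  qed
  then show ?thesis using h that by blast
qed

end

lemma (in group_hom) hom_word_eval:
  assumes f: "f \<in> S \<rightarrow> carrier G" and w: "w \<in> swords S"
  shows "h (word_eval G f w) = word_eval H (\<lambda>x. h (f x)) w"
  using w
proof (induction w)
  case (Cons a w)
  obtain x b where a: "a = (x, b)" by (cases a)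
  then have "f x \<in> carrier G" "word_eval G f w \<in> carrier G"
    using Cons f by auto
  then show ?case using a Cons by simp
qed simp

text \<open>This turns equalities of classes into equalities of products, so that relations between
  words become relations between group elements.\<close>

lemma word_eval_generators:
  assumes "w \<in> swords S"
  shows "word_eval (presented_group S R) (\<lambda>x. pres_class S R [(x, True)]) w = pres_class S R w"
  using assms
proof (induction w)
  case Nil
  then show ?case by (simp add: one_presented_group)
next
  case (Cons a w)
  interpret P: group "presented_group S R" by (rule group_presented_group)
  obtain x b where a: "a = (x, b)" by (cases a)
  with Cons have x: "x \<in> S" and w: "w \<in> swords S" by auto
  then have s: "[(x, b)] \<in> swords S" for b by auto
  have "pres_class S R [(x, False)] \<otimes>\<^bsub>presented_group S R\<^esub> pres_class S R [(x, True)]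
      = \<one>\<^bsub>presented_group S R\<^esub>"
    using pres_cong.cancel[OF x, of False R] x
    by (auto simp: pres_class_mult s one_presented_group pres_class_eq_iff)
  then have "inv\<^bsub>presented_group S R\<^esub> pres_class S R [(x, True)] = pres_class S R [(x, False)]"
    using s by (intro P.inv_equality) (auto simp: carrier_presented_group)
  then have "word_eval (presented_group S R) (\<lambda>x. pres_class S R [(x, True)]) (a # w)
      = pres_class S R [(x, b)] \<otimes>\<^bsub>presented_group S R\<^esub> pres_class S R w"
    using a Cons.IH w by auto
  also have "\<dots> = pres_class S R (a # w)"
    using pres_class_mult[OF s w] a by simp
  finally show ?case .
qed

lemma presented_group_hom_eqI:
  assumes "group H" "h \<in> hom (presented_group S R) H" "h' \<in> hom (presented_group S R) H"
    and eq: "\<And>x. x \<in> S \<Longrightarrow> h (pres_class S R [(x, True)]) = h' (pres_class S R [(x, True)])"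
    and A: "A \<in> carrier (presented_group S R)"
  shows "h A = h' A"
proof -
  let ?P = "presented_group S R" and ?f = "\<lambda>x. pres_class S R [(x, True)]"
  interpret h: group_hom ?P H h
    using assms group_presented_group by (simp add: group_hom_def group_hom_axioms_def)
  interpret h': group_hom ?P H h'
    using assms group_presented_group by (simp add: group_hom_def group_hom_axioms_def)
  obtain w where w: "w \<in> swords S" "A = pres_class S R w"
    using A by (auto simp: carrier_presented_group)
  have f: "?f \<in> S \<rightarrow> carrier ?P" by (auto simp: carrier_presented_group)
  have "word_eval H (\<lambda>x. h (?f x)) w = word_eval H (\<lambda>x. h' (?f x)) w"
    using w(1) by (induction w) (auto simp: eq)
  then show ?thesis
    using h.hom_word_eval[OF f w(1)] h'.hom_word_eval[OF f w(1)] w(2)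
    by (simp add: word_eval_generators[OF w(1)])
qed


section \<open>Products of consecutive elements\<close>

text \<open>Integer indices replace residues: shifts and reflections of an index then need no case
  distinction, and periodicity is imposed separately.\<close>

primrec run_prod :: "('g, 'r) monoid_scheme \<Rightarrow> (int \<Rightarrow> 'g) \<Rightarrow> int \<Rightarrow> nat \<Rightarrow> 'g" where
  "run_prod G x i 0 = \<one>\<^bsub>G\<^esub>"
| "run_prod G x i (Suc l) = x i \<otimes>\<^bsub>G\<^esub> run_prod G x (i + 1) l"

context group
begin

lemma run_prod_closed [intro, simp]:
  assumes "\<And>j. x j \<in> carrier G"
  shows "run_prod G x i l \<in> carrier G"
  by (induction l arbitrary: i) (auto simp: assms)

lemma run_prod_add:
  assumes "\<And>j. x j \<in> carrier G"
  shows "run_prod G x i (l + l') = run_prod G x i l \<otimes> run_prod G x (i + int l) l'"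
  by (induction l arbitrary: i) (auto simp: assms m_assoc algebra_simps)

lemma run_prod_Suc_right:
  assumes "\<And>j. x j \<in> carrier G"
  shows "run_prod G x i (Suc l) = run_prod G x i l \<otimes> x (i + int l)"
  using run_prod_add[where x = x and i = i and l = l and l' = 1, OF assms] assms by simp

text \<open>The long run splits into \<open>s\<close> blocks of length \<open>l\<close>, each equal
  to its neighbour by hypothesis.\<close>

lemma run_prod_mult:
  assumes x: "\<And>j. x j \<in> carrier G" and p: "\<And>j. run_prod G x (j + int l) l = run_prod G x j l"
  shows "run_prod G x i (s * l) = run_prod G x i l [^] s"
proof (induction s arbitrary: i)
  case (Suc s)
  have "run_prod G x i (Suc s * l) = run_prod G x i l \<otimes> run_prod G x (i + int l) l [^] s"
    by (simp add: run_prod_add[OF x] Suc)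
  also have "\<dots> = run_prod G x i l [^] Suc s"
    using x by (simp add: p nat_pow_Suc2 del: nat_pow_Suc Group.nat_pow_Suc)
  finally show ?case .
qed simp

text \<open>Inversion reverses the order of the factors and reflection of the indices reverses it
  again. With \<open>s = 2\<close> this governs the reflecting automorphism of the toric
  group.\<close>

lemma run_prod_inv_reflect:
  assumes x: "\<And>j. x j \<in> carrier G"
  shows "run_prod G (\<lambda>j. inv x (s - j)) i l = inv (run_prod G x (s + 1 - i - int l) l)"
proof (induction l arbitrary: i)
  case (Suc l)
  have "run_prod G x (s - i - int l) (Suc l) = run_prod G x (s - i - int l) l \<otimes> x (s - i)"
    using run_prod_Suc_right[where x = x and i = "s - i - int l" and l = l, OF x] by simp
  then have "inv (run_prod G x (s - i - int l) (Suc l))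
      = inv (x (s - i)) \<otimes> inv (run_prod G x (s - i - int l) l)"
    by (simp add: x inv_mult_group del: run_prod.simps)
  then show ?case using Suc[of "i + 1"] by (simp add: algebra_simps del: run_prod.simps(2))
      (simp add: algebra_simps)
qed simp

lemma shift_pow_commute:
  assumes x: "\<And>j. x j \<in> carrier G" and t: "t \<in> carrier G"
    and s: "\<And>j. t \<otimes> x j = x (j + d) \<otimes> t"
  shows "t [^] (l::nat) \<otimes> x i = x (i + int l * d) \<otimes> t [^] l"
proof (induction l arbitrary: i)
  case (Suc l)
  have "t [^] Suc l \<otimes> x i = t [^] l \<otimes> (t \<otimes> x i)"
    using x t by (simp add: m_assoc)
  also have "\<dots> = (t [^] l \<otimes> x (i + d)) \<otimes> t"
    using x t by (simp add: s m_assoc)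
  also have "\<dots> = x (i + d + int l * d) \<otimes> t [^] Suc l"
    using x t by (simp add: Suc m_assoc)
  finally show ?case by (simp add: algebra_simps)
qed (use x t in simp)

text \<open>In the induction step, moving \<open>t [^] l\<close> to the left past the last factor
  lowers the index of that factor to \<open>i\<close>, so one more copy of
  \<open>x i \<otimes> t\<close> splits off.\<close>

lemma run_prod_shift:
  assumes x: "\<And>j. x j \<in> carrier G" and t: "t \<in> carrier G"
    and s: "\<And>j. t \<otimes> x j = x (j + 1) \<otimes> t"
  shows "run_prod G x i l \<otimes> t [^] l = (x i \<otimes> t) [^] l"
proof (induction l)
  case (Suc l)
  have "run_prod G x i (Suc l) \<otimes> t [^] Suc l
      = run_prod G x i l \<otimes> (x (i + int l) \<otimes> t [^] l) \<otimes> t"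
    using x t by (simp add: run_prod_Suc_right[OF x] m_assoc del: run_prod.simps)
  also have "\<dots> = (run_prod G x i l \<otimes> t [^] l) \<otimes> (x i \<otimes> t)"
    using x t
    unfolding shift_pow_commute[where x = x and l = l and i = i and d = 1, OF x t s, simplified, symmetric]
    by (simp add: m_assoc)
  finally show ?case by (simp only: Suc nat_pow_Suc)
qed (use x t in simp)

end

lemma (in group_hom) hom_run_prod:
  assumes x: "\<And>j. x j \<in> carrier G"
  shows "h (run_prod G x i l) = run_prod H (\<lambda>j. h (x j)) i l"
  by (induction l arbitrary: i) (auto simp: x)

lemma periodic_int:
  fixes f :: "int \<Rightarrow> 'b"
  assumes "\<And>j. f (j + p) = f j"
  shows "f (j + z * p) = f j"
proof (induction z rule: int_induct[where k = 0])
  case (step1 z)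
  then show ?case using assms[of "j + z * p"] by (simp add: algebra_simps)
next
  case (step2 z)
  then show ?case using assms[of "j + (z - 1) * p"] by (simp add: algebra_simps)
qed simp

lemma run_prod_periodic:
  assumes "\<And>j. x (j + p) = x j"
  shows "run_prod G x (j + p) l = run_prod G x j l"
proof (induction l arbitrary: j)
  case (Suc l)
  then show ?case using Suc[of "j + 1"] by (simp add: assms add.assoc add.commute add.left_commute)
qed simp

lemma (in group) inv_cancel_left [simp]:
  assumes "g \<in> carrier G" "h \<in> carrier G"
  shows "inv g \<otimes> (g \<otimes> h) = h" and "g \<otimes> (inv g \<otimes> h) = h"
  using assms by (simp_all add: m_assoc[symmetric])

section \<open>Shift elements and the central element of a periodic family\<close>

locale toric_family = group G for G (structure) +
  fixes x :: "int \<Rightarrow> 'a" and n m q r :: nat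
  assumes x_closed [simp]: "x j \<in> carrier G"
    and x_periodic: "x (j + int n) = x j"
    and x_run: "run_prod G x j m = run_prod G x 1 m"
    and bezout: "m * q = n * r + 1"
begin

definition \<delta> where "\<delta> = run_prod G x 1 m"

text \<open>By \<open>bezout\<close>, \<open>q\<close> inverts \<open>m\<close> modulo
  \<open>n\<close>, so \<open>\<delta> [^] q\<close> lowers an index by one up to the period, and
  its inverse raises it by one.\<close>

definition t where "t = inv (\<delta> [^] q)"

lemma \<delta>_closed [simp]: "\<delta> \<in> carrier G"
  by (simp add: \<delta>_def)

lemma t_closed [simp]: "t \<in> carrier G"
  by (simp add: t_def)

text \<open>The run of length \<open>m + 1\<close> from \<open>j - int m\<close> can be split after
  its first or before its last factor; the other \<open>m\<close> factors multiply to
  \<open>\<delta>\<close> either way.\<close>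

lemma \<delta>_shift: "\<delta> \<otimes> x j = x (j + - int m) \<otimes> \<delta>"
  using run_prod.simps(2)[of G x "j - int m" m]
    run_prod_Suc_right[where x = x and i = "j - int m" and l = m, OF x_closed]
  by (simp add: x_run[of "j - int m"] x_run[of "j - int m + 1"] \<delta>_def)

lemma \<delta>_pow_shift: "\<delta> [^] s \<otimes> x j = x (j + int s * - int m) \<otimes> \<delta> [^] s"
  by (rule shift_pow_commute[where x = x, OF x_closed \<delta>_closed \<delta>_shift])

text \<open>The \<open>n\<close>-th power of \<open>\<delta>\<close> moves indices by a multiple of
  the period.\<close>

lemma \<delta>_pow_n_commute: "\<delta> [^] n \<otimes> x j = x j \<otimes> \<delta> [^] n"
  using \<delta>_pow_shift[of n j] periodic_int[where f = x and p = "int n" and z = "- int m" and j = j, OF x_periodic]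
  by (simp add: mult.commute)

text \<open>The same \<open>n * m\<close> consecutive factors are grouped in two ways: as
  \<open>n\<close> runs of length \<open>m\<close>, equal by \<open>x_run\<close>, and as
  \<open>m\<close> runs of length \<open>n\<close>, equal by periodicity.\<close>

lemma \<delta>_pow_n: "\<delta> [^] n = run_prod G x 1 n [^] m"
proof -
  have "run_prod G x 1 (n * m) = \<delta> [^] n"
    unfolding \<delta>_def using x_run by (intro run_prod_mult) (metis x_closed)+
  moreover have "run_prod G x 1 (m * n) = run_prod G x 1 n [^] m"
    by (intro run_prod_mult run_prod_periodic x_closed x_periodic)
  ultimately show ?thesis by (simp add: mult.commute)
qed

lemma t_shift: "t \<otimes> x j = x (j + 1) \<otimes> t"
proof -
  have "j + 1 + int q * - int m = j + - int r * int n"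
    using arg_cong[OF bezout, of int] by (simp add: algebra_simps)
  then have "x (j + 1 + int q * - int m) = x (j + - int r * int n)" by (rule arg_cong)
  then have "\<delta> [^] q \<otimes> x (j + 1) = x j \<otimes> \<delta> [^] q"
    using \<delta>_pow_shift[of q "j + 1"]
      periodic_int[where f = x and p = "int n" and z = "- int r" and j = j, OF x_periodic] by simp
  then have "t \<otimes> (\<delta> [^] q \<otimes> x (j + 1)) \<otimes> t = t \<otimes> (x j \<otimes> \<delta> [^] q) \<otimes> t"
    by simp
  then show ?thesis
    by (simp add: t_def m_assoc)
qed

lemma t_pow_n: "t [^] n = inv ((\<delta> [^] n) [^] q)"
  by (simp add: t_def nat_pow_inv nat_pow_pow mult.commute)

text \<open>By \<open>run_prod_shift\<close> the power equals
  \<open>\<delta> \<otimes> t [^] m\<close>, a power of \<open>\<delta>\<close> with exponent 1 - m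
  q = - n r.\<close>

lemma x_t_pow_m: "(x 1 \<otimes> t) [^] m = inv ((\<delta> [^] n) [^] r)"
proof -
  have "(x 1 \<otimes> t) [^] m = \<delta> \<otimes> inv (\<delta> [^] (q * m))"
    using run_prod_shift[where x = x and i = 1 and l = m, OF x_closed t_closed t_shift]
    by (simp add: \<delta>_def[symmetric] t_def nat_pow_inv nat_pow_pow)
  also have "\<delta> [^] (q * m) = \<delta> [^] (n * r) \<otimes> \<delta>"
    using bezout by (simp add: mult.commute)
  also have "\<delta> \<otimes> inv (\<delta> [^] (n * r) \<otimes> \<delta>) = inv ((\<delta> [^] n) [^] r)"
    by (simp add: inv_mult_group m_assoc[symmetric] nat_pow_pow)
  finally show ?thesis .
qed

text \<open>This gives the generators the same shape as the terms of \<open>conj_seq\<close>, with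
  \<open>t\<close> in the place of \<open>b\<close>.\<close>

lemma x_conj: "t [^] l \<otimes> x 1 \<otimes> inv (t [^] l) = x (1 + int l)"
  using shift_pow_commute[where x = x and l = l and i = 1, OF x_closed t_closed t_shift]
  by (simp add: m_assoc)

end

section \<open>Conjugates of one element by the powers of another\<close>

lemma (in group) conj_nat_pow:
  assumes "a \<in> carrier G" "g \<in> carrier G"
  shows "(g \<otimes> a \<otimes> inv g) [^] (l::nat) = g \<otimes> a [^] l \<otimes> inv g"
proof (induction l)
  case (Suc l)
  show ?case
    unfolding Group.nat_pow_Suc Suc using assms by (simp add: m_assoc)
qed (use assms in simp)

text \<open>These are the intended images of the toric generators; the offset in the exponent makes
  index 1 correspond to \<open>a\<close> itself.\<close>

definition conj_seq :: "('g, 'r) monoid_scheme \<Rightarrow> 'g \<Rightarrow> 'g \<Rightarrow> int \<Rightarrow> 'g" where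
  "conj_seq G a b j = b [^]\<^bsub>G\<^esub> (j - 1) \<otimes>\<^bsub>G\<^esub> a \<otimes>\<^bsub>G\<^esub> inv\<^bsub>G\<^esub> (b [^]\<^bsub>G\<^esub> (j - 1))"

context group
begin

context
  fixes a b :: 'a and k n m :: nat
  assumes a [simp]: "a \<in> carrier G" and b [simp]: "b \<in> carrier G"
    and ak: "a [^] k = \<one>" and bn: "b [^] n = \<one>" and abm: "(a \<otimes> b) [^] m = \<one>"
begin

lemma conj_seq_closed [simp]: "conj_seq G a b j \<in> carrier G"
  by (simp add: conj_seq_def)

lemma conj_seq_periodic: "conj_seq G a b (j + int n) = conj_seq G a b j"
proof -
  have "b [^] (j + int n - 1) = b [^] (j - 1) \<otimes> b [^] int n"
    by (simp add: int_pow_mult[symmetric] algebra_simps del: pow_nat)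
  then show ?thesis by (simp add: conj_seq_def bn int_pow_int)
qed

lemma conj_seq_pow: "conj_seq G a b j [^] k = \<one>"
  by (simp add: conj_seq_def conj_nat_pow ak)

lemma conj_seq_shift: "b \<otimes> conj_seq G a b j = conj_seq G a b (j + 1) \<otimes> b"
proof -
  have "b [^] j = b \<otimes> b [^] (j - 1)"
    using int_pow_mult[of b 1 "j - 1"] by simp
  then show ?thesis by (simp add: conj_seq_def inv_mult_group m_assoc)
qed

text \<open>\<open>run_prod_shift\<close> collapses the left side to a power of
  \<open>conj_seq G a b i \<otimes> b\<close>, which is a conjugate of \<open>a \<otimes> b\<close>
  because \<open>b\<close> commutes with its own powers.\<close>

lemma run_prod_conj_seq: "run_prod G (conj_seq G a b) i l \<otimes> b [^] l
    = b [^] (i - 1) \<otimes> (a \<otimes> b) [^] l \<otimes> inv (b [^] (i - 1))"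
proof -
  have "b \<otimes> b [^] (i - 1) = b [^] (i - 1) \<otimes> b"
    using int_pow_mult[of b 1 "i - 1"] int_pow_mult[of b "i - 1" 1] by simp
  then have "inv (b [^] (i - 1)) \<otimes> b = b \<otimes> inv (b [^] (i - 1))"
    by (metis b int_pow_closed inv_closed inv_solve_left inv_solve_right' m_assoc m_closed)
  then have "conj_seq G a b i \<otimes> b = b [^] (i - 1) \<otimes> (a \<otimes> b) \<otimes> inv (b [^] (i - 1))"
    by (simp add: conj_seq_def m_assoc)
  then show ?thesis
    using run_prod_shift[where x = "conj_seq G a b" and t = b and i = i and l = l, OF conj_seq_closed b conj_seq_shift]
    by (simp add: conj_nat_pow)
qed

text \<open>The factor \<open>(a \<otimes> b) [^] m\<close> is trivial, so nothing depends on the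
  start \<open>i\<close>: this is the toric run relation.\<close>

lemma run_prod_conj_seq_m: "run_prod G (conj_seq G a b) i m = inv (b [^] m)"
  using run_prod_conj_seq[of i m] by (intro inv_equality[symmetric]) (simp_all add: abm)

text \<open>Since \<open>b [^] n\<close> is trivial, the run is
  \<open>(a \<otimes> b) [^] n\<close>; exchanging the exponents \<open>n\<close> and
  \<open>m\<close> finishes. This yields the triviality of the image of \<open>c\<close>.\<close>

lemma run_prod_conj_seq_n: "run_prod G (conj_seq G a b) 1 n [^] m = \<one>"
proof -
  have "run_prod G (conj_seq G a b) 1 n = (a \<otimes> b) [^] n"
    using run_prod_conj_seq[of 1 n] by (simp add: bn)
  then show ?thesis by (simp add: nat_pow_pow mult.commute[of n] nat_pow_pow[symmetric] abm)
qed

end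

end

section \<open>Adjoining an involutive automorphism\<close>

text \<open>When \<open>\<theta>\<close> is an involutive automorphism, this is the semidirect
  product of \<open>G\<close> with a group of order two acting through \<open>\<theta>\<close>. The
  flag records a factor \<open>\<theta>\<close>, and inequality of flags is addition modulo
  2.\<close>

definition involution_product :: "('g, 'r) monoid_scheme \<Rightarrow> ('g \<Rightarrow> 'g) \<Rightarrow> ('g \<times> bool) monoid" where
  "involution_product G \<theta> =
    \<lparr>carrier = carrier G \<times> UNIV,
     monoid.mult = (\<lambda>(g, s) (h, u). (g \<otimes>\<^bsub>G\<^esub> (if s then \<theta> h else h), s \<noteq> u)),
     one = (\<one>\<^bsub>G\<^esub>, False)\<rparr>"

lemma carrier_involution_product: "carrier (involution_product G \<theta>) = carrier G \<times> UNIV"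
  and one_involution_product: "\<one>\<^bsub>involution_product G \<theta>\<^esub> = (\<one>\<^bsub>G\<^esub>, False)"
  and mult_involution_product:
    "(g, s) \<otimes>\<^bsub>involution_product G \<theta>\<^esub> (h, u) = (g \<otimes>\<^bsub>G\<^esub> (if s then \<theta> h else h), s \<noteq> u)"
  by (simp_all add: involution_product_def)

lemmas involution_product_simps =
  carrier_involution_product one_involution_product mult_involution_product

locale group_involution = group_hom G G \<theta> for G (structure) and \<theta> +
  assumes involution: "g \<in> carrier G \<Longrightarrow> \<theta> (\<theta> g) = g"
begin

abbreviation (input) "GI \<equiv> involution_product G \<theta>"

lemma group_GI: "group GI"
proof (rule groupI)
  fix A assume "A \<in> carrier GI"
  then obtain g s where A: "A = (g, s)" "g \<in> carrier G" by (auto simp: involution_product_simps)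
  then show "\<exists>B\<in>carrier GI. B \<otimes>\<^bsub>GI\<^esub> A = \<one>\<^bsub>GI\<^esub>"
    by (intro bexI[of _ "(if s then \<theta> (inv g) else inv g, s)"])
      (auto simp: involution_product_simps hom_mult[symmetric] simp del: hom_inv)
qed (auto simp: involution_product_simps G.m_assoc involution)

sublocale GI: group GI by (rule group_GI)

lemma inv_GI:
  assumes "g \<in> carrier G"
  shows "inv\<^bsub>GI\<^esub> (g, s) = (if s then \<theta> (inv g) else inv g, s)"
  using assms
  by (intro GI.inv_equality)
    (auto simp: involution_product_simps hom_mult[symmetric] simp del: hom_inv)

lemma embed_GI_hom: "(\<lambda>g. (g, False)) \<in> hom G GI"
  by (rule homI) (auto simp: involution_product_simps)

text \<open>Conjugation by an element with flag \<open>True\<close> first applies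
  \<open>\<theta>\<close> and then conjugates in \<open>G\<close>; hence the stability of
  \<open>N\<close> under \<open>\<theta>\<close>.\<close>

lemma normal_GI:
  assumes "N \<lhd> G" and \<theta>N: "\<And>g. g \<in> N \<Longrightarrow> \<theta> g \<in> N"
  shows "N \<times> {False} \<lhd> GI"
proof (rule GI.normal_invI)
  interpret N: normal N G by fact
  note N.subset[THEN subsetD, simp]
  have "N \<noteq> {}" using N.one_closed by blast
  then show "subgroup (N \<times> {False}) GI"
    using \<open>N \<noteq> {}\<close> by (intro GI.subgroupI) (auto simp: involution_product_simps inv_GI N.m_closed)
  fix A h assume "A \<in> carrier GI" "h \<in> N \<times> {False}"
  then obtain g s h' where A: "A = (g, s)" "g \<in> carrier G" "h = (h', False)" "h' \<in> N"
    by (auto simp: involution_product_simps)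
  then show "A \<otimes>\<^bsub>GI\<^esub> h \<otimes>\<^bsub>GI\<^esub> inv\<^bsub>GI\<^esub> A \<in> N \<times> {False}"
    using N.inv_op_closed2 \<theta>N
    by (auto simp: involution_product_simps inv_GI involution hom_inv[symmetric] simp del: hom_inv)
qed

end

section \<open>The toric reflection group\<close>

text \<open>The generators are extended to an \<open>n\<close>-periodic family on all integers, with
  representatives in \<open>{1..n}\<close>, as \<open>run_prod\<close> requires.\<close>

definition toric_gen :: "nat \<Rightarrow> nat \<Rightarrow> nat \<Rightarrow> int \<Rightarrow> nat sword set" where
  "toric_gen k n m j = pres_class {1..n} (toric_rels k n m) [(nat ((j - 1) mod int n) + 1, True)]"

lemma int_toric_index: "i \<ge> 1 \<Longrightarrow> nat ((int i - 1) mod int n) + 1 = toric_index n i"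
  by (simp add: toric_index_def nat_mod_as_int of_nat_diff)

lemma toric_index_range: "n \<ge> 1 \<Longrightarrow> nat ((j - 1) mod int n) + 1 \<in> {1..n}"
  by (auto simp: nat_less_iff Suc_le_eq)

lemma periodic_toric_index:
  fixes f :: "int \<Rightarrow> 'b"
  assumes n: "n \<ge> 1" and f: "\<And>j. f (j + int n) = f j"
  shows "f (int (nat ((j - 1) mod int n) + 1)) = f j"
proof -
  have "int (nat ((j - 1) mod int n) + 1) + (j - 1) div int n * int n = j"
    using n by simp
  then show ?thesis
    using periodic_int[where f = f and p = "int n", OF f] by metis
qed

lemma toric_word_Suc: "toric_word n i (Suc l) = (toric_index n i, True) # toric_word n (Suc i) l"
proof -
  have "[i..<i + Suc l] = i # [Suc i..<Suc i + l]" by (simp add: upt_rec[of i] del: upt_Suc)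
  then show ?thesis by (simp only: toric_word_def list.map)
qed

lemma toric_word_swords: "n \<ge> 1 \<Longrightarrow> toric_word n i l \<in> swords {1..n}"
  by (auto simp: toric_word_def toric_index_def Suc_le_eq)

lemma word_eval_toric_word:
  assumes "i \<ge> 1"
  shows "word_eval G f (toric_word n i l)
    = run_prod G (\<lambda>j. f (nat ((j - 1) mod int n) + 1)) (int i) l"
  using assms
proof (induction l arbitrary: i)
  case 0
  then show ?case by (simp add: toric_word_def)
next
  case (Suc l)
  have "int i + 1 = int (Suc i)" by simp
  then show ?case
    using Suc.IH[of "Suc i"] int_toric_index[OF Suc.prems, of n]
    by (simp only: toric_word_Suc word_eval_Cons run_prod.simps if_True)
qed

context
  fixes k n m :: nat
  assumes n: "n \<ge> 2"
begin

lemma group_toric_group: "group (toric_group k n m)"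
  by (simp add: toric_group_def group_presented_group)

lemma toric_gen_closed: "toric_gen k n m j \<in> carrier (toric_group k n m)"
  using toric_index_range[of n j] n
  by (auto simp: toric_gen_def toric_group_def carrier_presented_group)

lemma toric_gen_periodic: "toric_gen k n m (j + int n) = toric_gen k n m j"
proof -
  have "j + int n - 1 = (j - 1) + int n" by simp
  then show ?thesis unfolding toric_gen_def by (simp only: mod_add_self2)
qed

lemma toric_gen_of_nat:
  "i \<in> {1..n} \<Longrightarrow> toric_gen k n m (int i) = pres_class {1..n} (toric_rels k n m) [(i, True)]"
  unfolding toric_gen_def by (subst int_toric_index) (auto simp: toric_index_def)

lemma pres_class_toric_word:
  assumes "i \<ge> 1"
  shows "pres_class {1..n} (toric_rels k n m) (toric_word n i l)
    = run_prod (toric_group k n m) (toric_gen k n m) (int i) l"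
proof -
  have "toric_word n i l \<in> swords {1..n}" using n by (intro toric_word_swords) simp
  from word_eval_generators[OF this, of "toric_rels k n m"] show ?thesis
    by (simp add: word_eval_toric_word[OF assms] toric_group_def toric_gen_def[abs_def])
qed

text \<open>The presentation relates only the starts from 1 to \<open>n\<close>; periodicity reduces
  every integer start to one of these.\<close>

lemma toric_run_prod:
  "run_prod (toric_group k n m) (toric_gen k n m) j m = run_prod (toric_group k n m) (toric_gen k n m) 1 m"
proof -
  let ?p = "\<lambda>j. run_prod (toric_group k n m) (toric_gen k n m) j m"
  let ?i = "nat ((j - 1) mod int n) + 1"
  have "?p (int ?i) = ?p j"
    using n by (intro periodic_toric_index[where f = ?p] run_prod_periodic toric_gen_periodic) simp
  moreover have "?p (int ?i) = ?p 1"
  proof (cases "?i = 1")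
    case False
    then have i: "?i \<in> {2..n}" using toric_index_range[of n j] n by auto
    have s: "toric_word n 1 m \<in> swords {1..n}" "toric_word n ?i m \<in> swords {1..n}"
      using n by (intro toric_word_swords; simp)+
    have "(toric_word n 1 m, toric_word n ?i m) \<in> toric_rels k n m"
      using i unfolding toric_rels_def by blast
    then have "(toric_word n 1 m, toric_word n ?i m) \<in> pres_cong {1..n} (toric_rels k n m)"
      using s by (rule pres_cong.rel)
    then have "pres_class {1..n} (toric_rels k n m) (toric_word n 1 m)
        = pres_class {1..n} (toric_rels k n m) (toric_word n ?i m)"
      using pres_class_eq_iff[OF s] by simp
    then show ?thesis
      by (simp only: pres_class_toric_word le_add2 le_refl of_nat_1)
  next
    case True
    then show ?thesis by (simp only: of_nat_1)
  qed
  ultimately show ?thesis by simp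
qed

lemma toric_c_eq:
  "toric_c k n m = run_prod (toric_group k n m) (toric_gen k n m) 1 n [^]\<^bsub>toric_group k n m\<^esub> m"
  using pres_class_toric_word[of 1 n] by (simp add: toric_c_def)

lemma toric_gen_pow: "toric_gen k n m j [^]\<^bsub>toric_group k n m\<^esub> k = \<one>\<^bsub>toric_group k n m\<^esub>"
proof -
  interpret group "toric_group k n m" by (rule group_toric_group)
  let ?R = "toric_rels k n m" and ?i = "nat ((j - 1) mod int n) + 1"
  let ?f = "\<lambda>i. pres_class {1..n} ?R [(i, True)]"
  have i: "?i \<in> {1..n}" using n by (intro toric_index_range) simp
  have f: "?f \<in> {1..n} \<rightarrow> carrier (toric_group k n m)"
    by (auto simp: toric_group_def carrier_presented_group)
  have w: "replicate k (?i, True) \<in> swords {1..n}" using i by (intro in_listsI) (auto dest: in_set_replicate[THEN iffD1] simp del: set_replicate)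
  have "(replicate k (?i, True), []) \<in> pres_cong {1..n} ?R"
    using i by (intro pres_cong.rel w) (auto simp: toric_rels_def)
  then have "pres_class {1..n} ?R (replicate k (?i, True)) = pres_class {1..n} ?R []"
    using pres_class_eq_iff[OF w, of "[]"] by simp
  moreover have "pres_class {1..n} ?R (replicate k (?i, True)) = ?f ?i [^]\<^bsub>toric_group k n m\<^esub> k"
    using word_eval_generators[OF w, of ?R] word_eval_replicate[OF i f, of k]
    by (simp add: toric_group_def)
  ultimately show ?thesis by (simp add: toric_gen_def toric_group_def one_presented_group)
qed

text \<open>The universal property in terms of periodic families on the integers, so that targets
  are checked by \<open>run_prod\<close> identities instead of on words.\<close>

lemma toric_lift:
  assumes "group H"
    and y: "\<And>j. y j \<in> carrier H" and per: "\<And>j. y (j + int n) = y j"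
    and pow: "\<And>j. y j [^]\<^bsub>H\<^esub> k = \<one>\<^bsub>H\<^esub>"
    and run: "\<And>j. run_prod H y j m = run_prod H y 1 m"
  obtains h where "h \<in> hom (toric_group k n m) H" and "\<And>j. h (toric_gen k n m j) = y j"
proof -
  interpret H: group H by fact
  define f where "f i = y (int i)" for i
  have f: "f \<in> {1..n} \<rightarrow> carrier H" using y by (simp add: f_def)
  have fy: "f (nat ((j - 1) mod int n) + 1) = y j" for j
    unfolding f_def using n per by (intro periodic_toric_index) auto
  have tw: "word_eval H f (toric_word n i l) = run_prod H y (int i) l" if "i \<ge> 1" for i l
    using that by (simp only: word_eval_toric_word fy)
  have rel: "word_eval H f u = word_eval H f v" if "(u, v) \<in> toric_rels k n m" for u v
  proof -
    from that consider i where "i \<in> {1..n}" "u = replicate k (i, True)" "v = []"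
      | i where "i \<in> {2..n}" "u = toric_word n 1 m" "v = toric_word n i m"
      unfolding toric_rels_def by blast
    then show ?thesis
    proof cases
      case 1
      then show ?thesis using H.word_eval_replicate[OF 1(1) f] pow by (simp add: f_def)
    next
      case 2
      then show ?thesis using run[of "int i"] by (simp add: tw)
    qed
  qed
  obtain h where h: "h \<in> hom (toric_group k n m) H"
      "\<And>w. w \<in> swords {1..n} \<Longrightarrow> h (pres_class {1..n} (toric_rels k n m) w) = word_eval H f w"
    using H.presented_group_lift[OF f rel] unfolding toric_group_def by blast
  have "h (toric_gen k n m j) = y j" for j
  proof -
    have "[(nat ((j - 1) mod int n) + 1, True)] \<in> swords {1..n}"
      using toric_index_range[of n j] n by auto
    then show ?thesis
      unfolding toric_gen_def by (simp only: h(2) word_eval_Cons word_eval_Nil if_True fy H.r_one y)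
  qed
  with h(1) that show ?thesis by blast
qed

text \<open>The indices \<open>1 + int l\<close> meet every residue, and they are the ones reached
  from index 1 by conjugation with natural powers of \<open>t\<close>.\<close>

lemma toric_hom_eqI:
  assumes "group H" "h \<in> hom (toric_group k n m) H" "h' \<in> hom (toric_group k n m) H"
    and eq: "\<And>l. h (toric_gen k n m (1 + int l)) = h' (toric_gen k n m (1 + int l))"
    and A: "A \<in> carrier (toric_group k n m)"
  shows "h A = h' A"
proof (rule presented_group_hom_eqI[OF assms(1) assms(2,3)[unfolded toric_group_def] _ A[unfolded toric_group_def]])
  fix i assume i: "i \<in> {1..n}"
  then have "1 + int (i - 1) = int i" by auto
  then show "h (pres_class {1..n} (toric_rels k n m) [(i, True)])
      = h' (pres_class {1..n} (toric_rels k n m) [(i, True)])"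
    using eq[of "i - 1"] toric_gen_of_nat[OF i] by simp
qed

text \<open>Reversing words and reflecting indices preserves the relations, so inverting in addition
  gives an automorphism; on the Coxeter side it is conjugation by \<open>r\<^sub>2\<close>.\<close>

lemma toric_involution:
  obtains \<theta> where "group_involution (toric_group k n m) \<theta>"
    and "\<And>j. \<theta> (toric_gen k n m j) = inv\<^bsub>toric_group k n m\<^esub> toric_gen k n m (2 - j)"
proof -
  let ?W = "toric_group k n m" and ?x = "toric_gen k n m"
  interpret W: group ?W by (rule group_toric_group)
  note x = toric_gen_closed
  have per: "?x (2 - (j + int n)) = ?x (2 - j)" for j
    using toric_gen_periodic[of "2 - (j + int n)"] by simp
  \<comment> \<open>The reflected run starts at \<open>3 - j - int m\<close>, and by
    \<open>toric_run_prod\<close> its value is that of the run starting at 1.\<close>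
  have run: "run_prod ?W (\<lambda>j. inv\<^bsub>?W\<^esub> ?x (2 - j)) j m = inv\<^bsub>?W\<^esub> (run_prod ?W ?x 1 m)" for j
    using W.run_prod_inv_reflect[where x = ?x and s = 2 and i = j and l = m, OF x] toric_run_prod[of "3 - j - int m"]
    by simp
  obtain \<theta> where \<theta>: "\<theta> \<in> hom ?W ?W" "\<And>j. \<theta> (?x j) = inv\<^bsub>?W\<^esub> ?x (2 - j)"
  proof (rule toric_lift[of ?W "\<lambda>j. inv\<^bsub>?W\<^esub> ?x (2 - j)"])
    show "inv\<^bsub>?W\<^esub> ?x (2 - j) [^]\<^bsub>?W\<^esub> k = \<one>\<^bsub>?W\<^esub>" for j
      by (simp add: x W.nat_pow_inv toric_gen_pow)
  qed (simp_all add: x per run)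
  interpret \<theta>: group_hom ?W ?W \<theta>
    by unfold_locales (rule \<theta>(1))
  have "\<theta> (\<theta> g) = g" if "g \<in> carrier ?W" for g
  proof -
    have "(\<theta> \<circ> \<theta>) g = id g"
    proof (rule toric_hom_eqI[OF W.is_group _ _ _ that])
      show "\<theta> \<circ> \<theta> \<in> hom ?W ?W" by (rule hom_compose[OF \<theta>(1) \<theta>(1)])
      show "id \<in> hom ?W ?W" by (simp add: hom_def)
    qed (simp add: \<theta>(2) x)
    then show ?thesis by simp
  qed
  then have "group_involution ?W \<theta>"
    by unfold_locales
  with \<theta>(2) that show ?thesis by blast
qed

end

section \<open>The alternating subgroup\<close>

definition cox :: "nat \<Rightarrow> nat \<Rightarrow> nat \<Rightarrow> nat \<Rightarrow> nat sword set" where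
  "cox k n m i = pres_class {1, 2, 3} (coxeter_rels k n m) [(i, True)]"

context
  fixes k n m :: nat
begin

abbreviation (input) "Cox \<equiv> coxeter_group k n m"
abbreviation (input) "Alt \<equiv> alternating_group k n m"
abbreviation (input) "cox_a \<equiv> cox k n m 1 \<otimes>\<^bsub>coxeter_group k n m\<^esub> cox k n m 2"
abbreviation (input) "cox_b \<equiv> cox k n m 2 \<otimes>\<^bsub>coxeter_group k n m\<^esub> cox k n m 3"

lemma group_coxeter_group: "group Cox"
  by (simp add: coxeter_group_def group_presented_group)

interpretation Cox: group Cox by (rule group_coxeter_group)

lemma cox_closed [simp]: "i \<in> {1, 2, 3} \<Longrightarrow> cox k n m i \<in> carrier Cox"
  by (auto simp: cox_def coxeter_group_def carrier_presented_group)

lemma pres_class_coxeter: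
  assumes w: "w \<in> swords {1, 2, 3}"
  shows "pres_class {1, 2, 3} (coxeter_rels k n m) w = word_eval Cox (cox k n m) w"
  using word_eval_generators[OF w, of "coxeter_rels k n m"]
  by (simp add: coxeter_group_def cox_def[abs_def])

lemma word_eval_coxeter_rel:
  assumes "(u, []) \<in> coxeter_rels k n m" "u \<in> swords {1, 2, 3}"
  shows "word_eval Cox (cox k n m) u = \<one>\<^bsub>Cox\<^esub>"
proof -
  have "(u, []) \<in> pres_cong {1, 2, 3} (coxeter_rels k n m)"
    using assms by (intro pres_cong.rel) auto
  then have "pres_class {1, 2, 3} (coxeter_rels k n m) u = pres_class {1, 2, 3} (coxeter_rels k n m) []"
    using assms(2) by (subst pres_class_eq_iff) auto
  then show ?thesis
    using assms(2) by (simp only: pres_class_coxeter lists.Nil word_eval_Nil)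
qed

lemma cox_square:
  assumes "i \<in> {1, 2, 3}"
  shows "cox k n m i \<otimes>\<^bsub>Cox\<^esub> cox k n m i = \<one>\<^bsub>Cox\<^esub>"
proof -
  have "([(i, True), (i, True)], []) \<in> coxeter_rels k n m"
    using assms unfolding coxeter_rels_def by blast
  from word_eval_coxeter_rel[OF this] assms show ?thesis
    by (auto simp del: insert_iff)
qed

lemma cox_cancel:
  assumes "i \<in> {1, 2, 3}" "g \<in> carrier Cox"
  shows "cox k n m i \<otimes>\<^bsub>Cox\<^esub> (cox k n m i \<otimes>\<^bsub>Cox\<^esub> g) = g"
  using cox_square[OF assms(1)] assms by (simp add: Cox.m_assoc[symmetric] del: insert_iff)

lemma cox_pair_pow:
  assumes "i \<in> {1, 2, 3}" "j \<in> {1, 2, 3}"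
    and "(concat (replicate l [(i, True), (j, True)]), []) \<in> coxeter_rels k n m"
  shows "(cox k n m i \<otimes>\<^bsub>Cox\<^esub> cox k n m j) [^]\<^bsub>Cox\<^esub> l = \<one>\<^bsub>Cox\<^esub>"
proof -
  have w: "[(i, True), (j, True)] \<in> swords {1, 2, 3}" using assms by auto
  then have "concat (replicate l [(i, True), (j, True)]) \<in> swords {1, 2, 3}"
    by (induction l) auto
  from word_eval_coxeter_rel[OF assms(3) this]
  have "word_eval Cox (cox k n m) [(i, True), (j, True)] [^]\<^bsub>Cox\<^esub> l = \<one>\<^bsub>Cox\<^esub>"
    using Cox.word_eval_concat_replicate[OF w, of "cox k n m" l] by (simp add: Pi_def)
  then show ?thesis using assms(1,2) by (simp del: insert_iff)
qed

lemma subgroup_alternating_set: "subgroup (alternating_set k n m) Cox"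
  by (rule alternating_set_index_two)

lemma group_alternating_group: "group Alt"
  unfolding alternating_group_def by (rule Cox.subgroup_imp_group[OF subgroup_alternating_set])

interpretation Alt: group Alt by (rule group_alternating_group)

lemma carrier_Alt: "carrier Alt = alternating_set k n m"
  and mult_Alt: "x \<otimes>\<^bsub>Alt\<^esub> y = x \<otimes>\<^bsub>Cox\<^esub> y"
  and one_Alt: "\<one>\<^bsub>Alt\<^esub> = \<one>\<^bsub>Cox\<^esub>"
  by (simp_all add: alternating_group_def)

lemma pow_Alt: "x [^]\<^bsub>Alt\<^esub> (l::nat) = x [^]\<^bsub>Cox\<^esub> l"
  by (simp add: alternating_group_def nat_pow_def)

lemma cox_pair_Alt:
  assumes "i \<in> {1, 2, 3}" "j \<in> {1, 2, 3}"
  shows "cox k n m i \<otimes>\<^bsub>Cox\<^esub> cox k n m j \<in> carrier Alt"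
proof -
  have w: "[(i, True), (j, True)] \<in> swords {1, 2, 3}" using assms by auto
  have "pres_class {1, 2, 3} (coxeter_rels k n m) [(i, True), (j, True)] \<in> alternating_set k n m"
    using w even_word_length_coxeter[OF w, of k n m]
    by (auto simp: alternating_set_def coxeter_group_def carrier_presented_group)
  then show ?thesis
    using pres_class_coxeter[OF w] assms by (simp add: carrier_Alt del: insert_iff)
qed

lemma cox_a_Alt: "cox_a \<in> carrier Alt" and cox_b_Alt: "cox_b \<in> carrier Alt"
  by (rule cox_pair_Alt; simp)+

lemma cox_a_mult_cox_b: "cox_a \<otimes>\<^bsub>Alt\<^esub> cox_b = cox k n m 1 \<otimes>\<^bsub>Cox\<^esub> cox k n m 3"
  by (simp add: mult_Alt Cox.m_assoc cox_cancel)

lemma inv_cox_pair: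
  assumes "i \<in> {1, 2, 3}" "j \<in> {1, 2, 3}"
  shows "inv\<^bsub>Alt\<^esub> (cox k n m i \<otimes>\<^bsub>Cox\<^esub> cox k n m j) = cox k n m j \<otimes>\<^bsub>Cox\<^esub> cox k n m i"
  using assms cox_pair_Alt
  by (intro Alt.inv_equality) (simp_all add: mult_Alt one_Alt Cox.m_assoc cox_cancel cox_square del: insert_iff)

lemma cox_a_pow: "cox_a [^]\<^bsub>Alt\<^esub> k = \<one>\<^bsub>Alt\<^esub>"
  unfolding pow_Alt one_Alt by (rule cox_pair_pow) (auto simp: coxeter_rels_def)

lemma cox_b_pow: "cox_b [^]\<^bsub>Alt\<^esub> n = \<one>\<^bsub>Alt\<^esub>"
  unfolding pow_Alt one_Alt by (rule cox_pair_pow) (auto simp: coxeter_rels_def)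

text \<open>The product of \<open>cox_a\<close> and \<open>cox_b\<close> is r1 r3, the inverse of
  the product r3 r1 in the Coxeter relation.\<close>

lemma cox_a_mult_cox_b_pow: "(cox_a \<otimes>\<^bsub>Alt\<^esub> cox_b) [^]\<^bsub>Alt\<^esub> m = \<one>\<^bsub>Alt\<^esub>"
proof -
  have "cox_a \<otimes>\<^bsub>Alt\<^esub> cox_b = inv\<^bsub>Alt\<^esub> (cox k n m 3 \<otimes>\<^bsub>Cox\<^esub> cox k n m 1)"
    unfolding cox_a_mult_cox_b by (rule inv_cox_pair[symmetric]) auto
  moreover have "(cox k n m 3 \<otimes>\<^bsub>Cox\<^esub> cox k n m 1) [^]\<^bsub>Alt\<^esub> m = \<one>\<^bsub>Alt\<^esub>"
    unfolding pow_Alt one_Alt by (rule cox_pair_pow) (auto simp: coxeter_rels_def)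
  ultimately show ?thesis
    using cox_pair_Alt[of 3 1] by (simp add: Alt.nat_pow_inv)
qed

text \<open>An even word splits into pairs of Coxeter generators, and the product of a pair is
  trivial, or \<open>cox_a\<close>, \<open>cox_b\<close> or their product, or an inverse of one of
  these.\<close>

lemma alternating_group_generated:
  assumes H: "subgroup H Alt" and cox_a: "cox_a \<in> H" and cox_b: "cox_b \<in> H"
  shows "H = carrier Alt"
proof
  interpret H: subgroup H Alt by fact
  have pair: "cox k n m i \<otimes>\<^bsub>Cox\<^esub> cox k n m j \<in> H" if ij: "i \<in> {1, 2, 3}" "j \<in> {1, 2, 3}" for i j
  proof -
    have 1: "cox k n m 1 \<otimes>\<^bsub>Cox\<^esub> cox k n m 3 \<in> H"
      using H.m_closed[OF cox_a cox_b] by (simp only: cox_a_mult_cox_b)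
    have 2: "cox k n m i \<otimes>\<^bsub>Cox\<^esub> cox k n m i \<in> H" if "i \<in> {1, 2, 3}" for i
      using cox_square[OF that] H.one_closed by (simp add: one_Alt)
    have 3: "cox k n m j \<otimes>\<^bsub>Cox\<^esub> cox k n m i \<in> H"
      if "i \<in> {1, 2, 3}" "j \<in> {1, 2, 3}" "cox k n m i \<otimes>\<^bsub>Cox\<^esub> cox k n m j \<in> H" for i j
      using H.m_inv_closed[OF that(3)] by (simp only: inv_cox_pair[OF that(1,2)])
    consider "i = j" | "i = 1" "j = 2" | "i = 2" "j = 3" | "i = 1" "j = 3"
      | "j = 1" "i = 2" | "j = 2" "i = 3" | "j = 1" "i = 3"
      using ij by auto
    then show ?thesis
    proof cases
    qed (use cox_a cox_b 1 2[OF ij(2)] 3 in simp_all)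
  qed
  have even: "word_eval Cox (cox k n m) (map (\<lambda>i. (i, True)) is) \<in> H"
    if "set is \<subseteq> {1, 2, 3}" "even (length is)" for "is"
    using that
  proof (induction "is" rule: induct_list012)
    case (3 i j "is")
    then have ij: "i \<in> {1, 2, 3}" "j \<in> {1, 2, 3}" "map (\<lambda>i. (i, True)) is \<in> swords {1, 2, 3}"
      by auto
    have "word_eval Cox (cox k n m) (map (\<lambda>i. (i, True)) is) \<in> H"
      using 3 by simp
    from H.m_closed[OF pair[OF ij(1,2)] this] show ?case
      using ij Cox.word_eval_closed[OF _ ij(3), of "cox k n m"]
      by (simp add: mult_Alt Cox.m_assoc Pi_def del: insert_iff)
  qed (use H.one_closed in \<open>simp_all add: one_Alt\<close>)
  show "carrier Alt \<subseteq> H"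
  proof
    fix g assume "g \<in> carrier Alt"
    then obtain w where w: "w \<in> swords {1, 2, 3}"
        "g = pres_class {1, 2, 3} (coxeter_rels k n m) w" "even (length w)"
      using even_word_length_coxeter[of _ k n m]
      by (auto simp: carrier_Alt alternating_set_def coxeter_group_def carrier_presented_group)
    let ?w = "map (\<lambda>i. (i, True)) (map fst w)"
    have w': "?w \<in> swords {1, 2, 3}" "set (map fst w) \<subseteq> {1, 2, 3}"
      using w(1) by fastforce+
    have "g = word_eval Cox (cox k n m) ?w"
      using coxeter_positive_word[OF w(1), of k n m] pres_class_eq_iff[OF w(1) w'(1)]
        pres_class_coxeter[OF w'(1)] w(2) by metis
    then show "g \<in> H" using even[OF w'(2)] w(3) by simp
  qed
qed (use H subgroup.subset in blast)

lemma coxeter_lift: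
  assumes "group H" and f: "f \<in> {1, 2, 3} \<rightarrow> carrier H"
    and sq: "\<And>i. i \<in> {1, 2, 3} \<Longrightarrow> f i \<otimes>\<^bsub>H\<^esub> f i = \<one>\<^bsub>H\<^esub>"
    and pow: "(f 1 \<otimes>\<^bsub>H\<^esub> f 2) [^]\<^bsub>H\<^esub> k = \<one>\<^bsub>H\<^esub>"
      "(f 2 \<otimes>\<^bsub>H\<^esub> f 3) [^]\<^bsub>H\<^esub> n = \<one>\<^bsub>H\<^esub>" "(f 3 \<otimes>\<^bsub>H\<^esub> f 1) [^]\<^bsub>H\<^esub> m = \<one>\<^bsub>H\<^esub>"
  obtains h where "h \<in> hom Cox H" and "\<And>i. i \<in> {1, 2, 3} \<Longrightarrow> h (cox k n m i) = f i"
proof -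
  interpret H: group H by fact
  have f': "f i \<in> carrier H" if "i \<in> {1, 2, 3}" for i using f that by blast
  have pair: "word_eval H f (concat (replicate l [(i, True), (j, True)])) = (f i \<otimes>\<^bsub>H\<^esub> f j) [^]\<^bsub>H\<^esub> l"
    if "i \<in> {1, 2, 3}" "j \<in> {1, 2, 3}" for i j l
  proof -
    have "[(i, True), (j, True)] \<in> swords {1, 2, 3}" using that by auto
    from H.word_eval_concat_replicate[OF this f] show ?thesis
      using f'[OF that(1)] f'[OF that(2)] by simp
  qed
  have rel: "word_eval H f u = word_eval H f v" if "(u, v) \<in> coxeter_rels k n m" for u v
  proof -
    from that consider i where "i \<in> {1, 2, 3}" "u = [(i, True), (i, True)]" "v = []"
      | "u = concat (replicate k [(1, True), (2, True)])" "v = []"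
      | "u = concat (replicate n [(2, True), (3, True)])" "v = []"
      | "u = concat (replicate m [(3, True), (1, True)])" "v = []"
      unfolding coxeter_rels_def by blast
    then show ?thesis
    proof cases
      case 1
      then show ?thesis using sq[OF 1(1)] f'[OF 1(1)] by simp
    next
      case 2
      then show ?thesis using pair[of 1 2 k] pow by simp
    next
      case 3
      then show ?thesis using pair[of 2 3 n] pow by simp
    next
      case 4
      then show ?thesis using pair[of 3 1 m] pow by simp
    qed
  qed
  obtain h where h: "h \<in> hom Cox H"
      "\<And>w. w \<in> swords {1, 2, 3} \<Longrightarrow> h (pres_class {1, 2, 3} (coxeter_rels k n m) w) = word_eval H f w"
    using H.presented_group_lift[OF f rel] unfolding coxeter_group_def by blast
  have "h (cox k n m i) = f i" if "i \<in> {1, 2, 3}" for i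
  proof -
    have "[(i, True)] \<in> swords {1, 2, 3}" using that by auto
    then show ?thesis
      unfolding cox_def by (simp only: h(2) word_eval_Cons word_eval_Nil if_True H.r_one f'[OF that])
  qed
  with h(1) that show ?thesis by blast
qed

end

text \<open>Commuting with \<open>g\<close> passes to products, and to the inverse of
  \<open>c\<close> by cancelling \<open>c\<close>.\<close>

lemma (in group) central_generate_singleton:
  assumes c: "c \<in> carrier G" and comm: "\<And>g. g \<in> carrier G \<Longrightarrow> c \<otimes> g = g \<otimes> c"
    and z: "z \<in> generate G {c}" and g: "g \<in> carrier G"
  shows "z \<otimes> g = g \<otimes> z"
  using z g
proof (induction arbitrary: g)
  case (inv h)
  then have "c \<otimes> (inv c \<otimes> g) = c \<otimes> (g \<otimes> inv c)"
    using c comm[of "g \<otimes> inv c"] by (simp add: m_assoc)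
  then show ?case
    using c inv l_cancel[of c "inv c \<otimes> g" "g \<otimes> inv c"] by (simp del: inv_cancel_left)
next
  case (eng h1 h2)
  then have "h1 \<in> carrier G" "h2 \<in> carrier G"
    using c generate_in_carrier[of "{c}"] by auto
  then show ?case
    using eng.IH eng.prems by (metis m_assoc)
qed (use c comm in auto)

theorem theorem1p4:
  fixes k n m :: nat
  assumes "k \<ge> 2" and "n \<ge> 2" and "m \<ge> 2" and "n < m" and "coprime n m"
  shows "(\<forall>z\<in>generate (toric_group k n m) {toric_c k n m}. \<forall>g\<in>carrier (toric_group k n m).
            z \<otimes>\<^bsub>toric_group k n m\<^esub> g = g \<otimes>\<^bsub>toric_group k n m\<^esub> z)
       \<and> (\<exists>\<pi>. short_exact_sequence
            (alternating_group k n m)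
            (toric_group k n m)
            ((toric_group k n m)\<lparr>carrier := generate (toric_group k n m) {toric_c k n m}\<rparr>)
            \<pi> id)"
proof -
  note n = assms(2)
  let ?x = "toric_gen k n m"
  define W where "W = toric_group k n m"
  define Cox where "Cox = coxeter_group k n m"
  define Alt where "Alt = alternating_group k n m"
  interpret W: group W unfolding W_def by (rule group_toric_group[OF n])
  interpret Alt: group Alt unfolding Alt_def by (rule group_alternating_group)
  \<comment> \<open>Coprimality makes \<open>m\<close> invertible modulo \<open>n\<close>;
    \<open>q\<close> is such an inverse.\<close>
  obtain q r where qr: "m * q = n * r + 1"
    using bezout_nat[of m n] assms by (auto simp: coprime_iff_gcd_eq_1 gcd.commute)
  interpret T: toric_family W ?x n m q r
    unfolding W_def using n
    by (intro toric_family.intro toric_family_axioms.intro group_toric_group toric_gen_closed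
        toric_gen_periodic toric_run_prod qr)
  \<comment> \<open>The power of \<open>\<delta>\<close> is the form in which centrality is visible;
    \<open>\<delta>_pow_n\<close> identifies it with \<open>toric_c\<close>.\<close>
  define c where "c = T.\<delta> [^]\<^bsub>W\<^esub> n"
  have c_eq: "toric_c k n m = c"
    unfolding c_def T.\<delta>_pow_n unfolding W_def by (rule toric_c_eq[OF n])
  have c: "c \<in> carrier W" by (simp add: c_def)
  define K where "K = generate W {c}"
  have subK: "subgroup K W" unfolding K_def using c by (intro W.generate_is_subgroup) simp
  interpret K: subgroup K W by (rule subK)
  have cK: "c \<in> K" unfolding K_def by (intro generate.incl) simp

  have c_comm: "c \<otimes>\<^bsub>W\<^esub> g = g \<otimes>\<^bsub>W\<^esub> c" if g: "g \<in> carrier W" for g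
  proof -
    \<comment> \<open>Conjugation by \<open>c\<close> is an endomorphism that fixes every generator,
      hence the identity.\<close>
    have "c \<otimes>\<^bsub>W\<^esub> g \<otimes>\<^bsub>W\<^esub> inv\<^bsub>W\<^esub> c = id g"
    proof (rule toric_hom_eqI[OF n W.is_group,
          where h = "\<lambda>g. c \<otimes>\<^bsub>W\<^esub> g \<otimes>\<^bsub>W\<^esub> inv\<^bsub>W\<^esub> c" and h' = id and k = k and m = m, folded W_def])
      show "(\<lambda>g. c \<otimes>\<^bsub>W\<^esub> g \<otimes>\<^bsub>W\<^esub> inv\<^bsub>W\<^esub> c) \<in> hom W W"
        using c by (intro homI) (simp_all add: W.m_assoc)
      show "c \<otimes>\<^bsub>W\<^esub> ?x (1 + int l) \<otimes>\<^bsub>W\<^esub> inv\<^bsub>W\<^esub> c = id (?x (1 + int l))" for l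
        using T.\<delta>_pow_n_commute[of "1 + int l"] c by (simp add: c_def[symmetric] W.m_assoc)
    qed (use g in \<open>simp_all add: hom_def\<close>)
    then show ?thesis using c g by (metis W.inv_solve_right' W.m_closed id_apply)
  qed
  have central: "z \<otimes>\<^bsub>W\<^esub> g = g \<otimes>\<^bsub>W\<^esub> z" if "z \<in> K" "g \<in> carrier W" for z g
    using W.central_generate_singleton[OF c c_comm] that by (simp add: K_def)
  have normK: "K \<lhd> W"
  proof (rule W.normal_invI[OF subK])
    fix g h assume "g \<in> carrier W" "h \<in> K"
    then show "g \<otimes>\<^bsub>W\<^esub> h \<otimes>\<^bsub>W\<^esub> inv\<^bsub>W\<^esub> g \<in> K"
      using central[of h "inv\<^bsub>W\<^esub> g"] by (simp add: W.m_assoc K.subset[THEN subsetD])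
  qed

  \<comment> \<open>The reflecting automorphism on \<open>c\<close>, \<open>K\<close> and
    \<open>t\<close>\<close>
  obtain \<theta> where inv\<theta>: "group_involution W \<theta>" and \<theta>x: "\<And>j. \<theta> (?x j) = inv\<^bsub>W\<^esub> ?x (2 - j)"
    using toric_involution[OF n, of k m] unfolding W_def by blast
  interpret \<theta>: group_involution W \<theta> by (rule inv\<theta>)
  \<comment> \<open>The run defining \<open>\<delta>\<close> goes to the inverse of the run from
    \<open>2 - int m\<close>, which is \<open>\<delta>\<close> again.\<close>
  have \<theta>\<delta>: "\<theta> T.\<delta> = inv\<^bsub>W\<^esub> T.\<delta>"
    using W.run_prod_inv_reflect[where x = ?x and s = 2 and i = 1 and l = m, OF T.x_closed]
      \<theta>.hom_run_prod[where x = ?x and i = 1 and l = m, OF T.x_closed] T.x_run[of "2 - int m"]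
    by (simp add: \<theta>x T.\<delta>_def)
  have \<theta>c: "\<theta> c = inv\<^bsub>W\<^esub> c"
    by (simp add: c_def \<theta>.hom_nat_pow \<theta>\<delta> W.nat_pow_inv)
  \<comment> \<open>The elements of \<open>K\<close> are powers of \<open>c\<close>, and
    \<open>\<theta>\<close> inverts these.\<close>
  have \<theta>K: "\<theta> z \<in> K" if z: "z \<in> K" for z
  proof -
    obtain i :: int where i: "z = c [^]\<^bsub>W\<^esub> i" using z c by (auto simp: K_def W.generate_pow)
    then have "\<theta> z = inv\<^bsub>W\<^esub> z" using c by (simp add: \<theta>.hom_int_pow \<theta>c W.int_pow_inv)
    then show ?thesis using z by simp
  qed
  have \<theta>t: "\<theta> T.t = inv\<^bsub>W\<^esub> T.t"
    by (simp add: T.t_def \<theta>.hom_nat_pow \<theta>\<delta> W.nat_pow_inv)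
  have c_powK: "inv\<^bsub>W\<^esub> (c [^]\<^bsub>W\<^esub> (l::nat)) \<in> K" for l
    using cK by (induction l) (auto simp: c W.inv_mult_group)
  have tK: "T.t [^]\<^bsub>W\<^esub> n \<in> K"
    using c_powK[of q] by (simp add: T.t_pow_n c_def)
  have xtK: "(?x 1 \<otimes>\<^bsub>W\<^esub> T.t) [^]\<^bsub>W\<^esub> m \<in> K"
    using c_powK[of r] by (simp add: T.x_t_pow_m c_def)

  \<comment> \<open>The semidirect product modulo \<open>K\<close> as a target of the Coxeter
    group\<close>
  let ?GI = "involution_product W \<theta>"
  let ?N = "K \<times> {False}"
  have normN: "?N \<lhd> ?GI" by (rule \<theta>.normal_GI[OF normK \<theta>K])
  interpret N: normal ?N ?GI by (rule normN)
  define Q where "Q = ?GI Mod ?N"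
  interpret Q: group Q unfolding Q_def by (rule N.factorgroup_is_group)
  define p where "p A = ?N #>\<^bsub>?GI\<^esub> A" for A
  have "p \<in> hom ?GI Q" unfolding Q_def p_def by (rule N.r_coset_hom_Mod)
  then interpret p: group_hom ?GI Q p by unfold_locales
  have p_one: "p A = \<one>\<^bsub>Q\<^esub> \<longleftrightarrow> A \<in> ?N" if "A \<in> carrier ?GI" for A
    using \<theta>.GI.coset_join2[OF that N.subgroup_axioms] \<theta>.GI.coset_join1[OF _ that N.subgroup_axioms] that
    by (auto simp: p_def Q_def FactGroup_def)
  have E_hom: "(\<lambda>g. p (g, False)) \<in> hom W Q"
    using hom_compose[OF \<theta>.embed_GI_hom p.homh] by (simp add: comp_def)
  interpret E: group_hom W Q "\<lambda>g. p (g, False)"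
    by unfold_locales (rule E_hom)

  \<comment> \<open>The second image is \<open>\<theta>\<close> itself; the other two are chosen so
    that \<open>R 1\<close> times \<open>R 2\<close> is \<open>?x 1\<close> and \<open>R 2\<close>
    times \<open>R 3\<close> is \<open>T.t\<close>. Every index other than 1 and 2 receives the
    value meant for 3.\<close>
  define R where "R i = (if i = (1::nat) then ?x 1 else if i = 2 then \<one>\<^bsub>W\<^esub> else inv\<^bsub>W\<^esub> T.t, True)" for i
  have R: "R i \<in> carrier ?GI" for i by (simp add: R_def carrier_involution_product)
  have R_mult: "R 1 \<otimes>\<^bsub>?GI\<^esub> R 2 = (?x 1, False)" "R 2 \<otimes>\<^bsub>?GI\<^esub> R 3 = (T.t, False)"
      "R 3 \<otimes>\<^bsub>?GI\<^esub> R 1 = (inv\<^bsub>W\<^esub> (?x 1 \<otimes>\<^bsub>W\<^esub> T.t), False)"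
    by (simp_all add: R_def mult_involution_product \<theta>t \<theta>x W.inv_mult_group)
  \<comment> \<open>In \<open>Q\<close> a Coxeter relation only needs the corresponding power to lie
    in \<open>K\<close>.\<close>
  have pR_pow: "(p (R i) \<otimes>\<^bsub>Q\<^esub> p (R j)) [^]\<^bsub>Q\<^esub> l = \<one>\<^bsub>Q\<^esub>"
    if "R i \<otimes>\<^bsub>?GI\<^esub> R j = (g, False)" "g \<in> carrier W" "g [^]\<^bsub>W\<^esub> l \<in> K" for i j g and l :: nat
  proof -
    have "(p (R i) \<otimes>\<^bsub>Q\<^esub> p (R j)) [^]\<^bsub>Q\<^esub> l = p (g [^]\<^bsub>W\<^esub> l, False)"
      using that by (simp add: R p.hom_mult[symmetric] E.hom_nat_pow del: p.hom_mult)
    also have "\<dots> = \<one>\<^bsub>Q\<^esub>"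
      using that by (subst p_one) (auto simp: carrier_involution_product)
    finally show ?thesis .
  qed
  have pR: "(\<lambda>i. p (R i)) \<in> {1, 2, 3} \<rightarrow> carrier Q" using R by simp
  have pR_sq: "p (R i) \<otimes>\<^bsub>Q\<^esub> p (R i) = \<one>\<^bsub>Q\<^esub>" for i
  proof -
    \<comment> \<open>The automorphism inverts \<open>?x 1\<close>, because index 1 is fixed by the
      reflection, and it inverts \<open>T.t\<close>.\<close>
    have "R i \<otimes>\<^bsub>?GI\<^esub> R i = \<one>\<^bsub>?GI\<^esub>"
      by (simp add: R_def mult_involution_product one_involution_product \<theta>t \<theta>x)
    then show ?thesis using p.hom_mult[OF R R, of i i] by simp
  qed
  have pR12: "(p (R 1) \<otimes>\<^bsub>Q\<^esub> p (R 2)) [^]\<^bsub>Q\<^esub> k = \<one>\<^bsub>Q\<^esub>"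
    using toric_gen_pow[OF n, of k m 1, folded W_def] by (intro pR_pow[OF R_mult(1)]) simp_all
  have pR23: "(p (R 2) \<otimes>\<^bsub>Q\<^esub> p (R 3)) [^]\<^bsub>Q\<^esub> n = \<one>\<^bsub>Q\<^esub>"
    using tK by (intro pR_pow[OF R_mult(2)]) simp_all
  have pR31: "(p (R 3) \<otimes>\<^bsub>Q\<^esub> p (R 1)) [^]\<^bsub>Q\<^esub> m = \<one>\<^bsub>Q\<^esub>"
    using xtK by (intro pR_pow[OF R_mult(3)]) (simp_all add: W.nat_pow_inv)
  obtain \<psi> where \<psi>: "\<psi> \<in> hom Cox Q" "\<And>i. i \<in> {1, 2, 3} \<Longrightarrow> \<psi> (cox k n m i) = p (R i)"
    using coxeter_lift[OF Q.is_group pR pR_sq pR12 pR23 pR31] unfolding Cox_def by blast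

  \<comment> \<open>The projection onto the alternating group\<close>
  define a where "a = cox k n m 1 \<otimes>\<^bsub>Cox\<^esub> cox k n m 2"
  define b where "b = cox k n m 2 \<otimes>\<^bsub>Cox\<^esub> cox k n m 3"
  have a: "a \<in> carrier Alt" and b: "b \<in> carrier Alt"
    unfolding a_def b_def Cox_def Alt_def by (rule cox_a_Alt cox_b_Alt)+
  have rels: "a [^]\<^bsub>Alt\<^esub> k = \<one>\<^bsub>Alt\<^esub>" "b [^]\<^bsub>Alt\<^esub> n = \<one>\<^bsub>Alt\<^esub>" "(a \<otimes>\<^bsub>Alt\<^esub> b) [^]\<^bsub>Alt\<^esub> m = \<one>\<^bsub>Alt\<^esub>"
    unfolding a_def b_def Cox_def Alt_def by (rule cox_a_pow cox_b_pow cox_a_mult_cox_b_pow)+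
  have \<psi>_Alt: "\<psi> \<in> hom Alt Q"
    using \<psi>(1) subgroup.subset[OF subgroup_alternating_set, of k n m]
    by (auto simp: hom_def Cox_def Alt_def alternating_group_def Pi_def subset_iff)
  interpret \<psi>: group_hom Alt Q \<psi>
    by unfold_locales (rule \<psi>_Alt)
  have \<psi>_mult: "\<psi> (cox k n m i \<otimes>\<^bsub>Cox\<^esub> cox k n m j) = p (R i \<otimes>\<^bsub>?GI\<^esub> R j)"
    if "i \<in> {1, 2, 3}" "j \<in> {1, 2, 3}" for i j
    using that hom_mult[OF \<psi>(1)] cox_closed[of _ k n m] R by (simp add: Cox_def \<psi>(2) del: insert_iff)
  have \<psi>a: "\<psi> a = p (?x 1, False)" and \<psi>b: "\<psi> b = p (T.t, False)"
    using \<psi>_mult[of 1 2] \<psi>_mult[of 2 3] by (simp_all add: a_def b_def R_mult[simplified])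

  let ?y = "conj_seq Alt a b"
  obtain \<pi> where \<pi>: "\<pi> \<in> hom W Alt" "\<And>j. \<pi> (?x j) = ?y j"
    unfolding W_def
  proof (rule toric_lift[OF n Alt.is_group, of ?y k m])
    show "run_prod Alt ?y j m = run_prod Alt ?y 1 m" for j
      by (simp only: Alt.run_prod_conj_seq_m[OF a b rels])
  qed (simp_all add: Alt.conj_seq_periodic[OF a b rels] Alt.conj_seq_pow[OF a b rels]
        Alt.conj_seq_closed[OF a b rels])
  interpret \<pi>: group_hom W Alt \<pi>
    by unfold_locales (rule \<pi>(1))
  have \<pi>_run: "\<pi> (run_prod W ?x i l) = run_prod Alt ?y i l" for i l
    using \<pi>.hom_run_prod[where x = ?x, OF T.x_closed] by (simp add: \<pi>(2))
  have \<pi>c: "\<pi> c = \<one>\<^bsub>Alt\<^esub>"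
    by (simp add: c_def T.\<delta>_pow_n \<pi>.hom_nat_pow \<pi>_run Alt.run_prod_conj_seq_n[OF a b rels])
  \<comment> \<open>Both sides are homomorphisms on \<open>W\<close>, compared on generators:
    \<open>\<pi>\<close> sends \<open>?x (1 + int l)\<close> to a conjugate of \<open>a\<close> by a
    power of \<open>b\<close>, and \<open>\<psi>\<close> turns it into the image of the conjugate of
    \<open>?x 1\<close> by the same power of \<open>T.t\<close>, which is
    \<open>?x (1 + int l)\<close> by \<open>x_conj\<close>.\<close>
  have \<psi>\<pi>: "\<psi> (\<pi> g) = p (g, False)" if g: "g \<in> carrier W" for g
  proof -
    have "(\<psi> \<circ> \<pi>) g = p (g, False)"
    proof (rule toric_hom_eqI[OF n Q.is_group, where k = k and m = m, folded W_def, OF _ E_hom _ g])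
      show "\<psi> \<circ> \<pi> \<in> hom W Q" by (rule hom_compose[OF \<pi>(1) \<psi>_Alt])
      fix l
      have "\<pi> (?x (1 + int l)) = b [^]\<^bsub>Alt\<^esub> l \<otimes>\<^bsub>Alt\<^esub> a \<otimes>\<^bsub>Alt\<^esub> inv\<^bsub>Alt\<^esub> (b [^]\<^bsub>Alt\<^esub> l)"
        by (simp add: \<pi>(2) conj_seq_def int_pow_int)
      then have "\<psi> (\<pi> (?x (1 + int l)))
          = p (T.t [^]\<^bsub>W\<^esub> l \<otimes>\<^bsub>W\<^esub> ?x 1 \<otimes>\<^bsub>W\<^esub> inv\<^bsub>W\<^esub> (T.t [^]\<^bsub>W\<^esub> l), False)"
        using a b by (simp add: \<psi>.hom_nat_pow E.hom_nat_pow \<psi>a \<psi>b)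
      then show "(\<psi> \<circ> \<pi>) (?x (1 + int l)) = p (?x (1 + int l), False)"
        by (simp only: T.x_conj comp_apply)
    qed
    then show ?thesis by simp
  qed

  \<comment> \<open>Kernel, image and exactness\<close>
  have ker: "kernel W Alt \<pi> = K"
  proof
    show "kernel W Alt \<pi> \<subseteq> K"
    proof
      fix g assume "g \<in> kernel W Alt \<pi>"
      then have g: "g \<in> carrier W" "\<pi> g = \<one>\<^bsub>Alt\<^esub>" by (auto simp: kernel_def)
      \<comment> \<open>Since \<open>p\<close> on \<open>W\<close> factors through
        \<open>\<pi>\<close> and kills only elements of \<open>K\<close>, the kernel of
        \<open>\<pi>\<close> cannot be larger than \<open>K\<close>.\<close>
      then have "p (g, False) = \<one>\<^bsub>Q\<^esub>" using \<psi>\<pi>[of g] by simp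
      then show "g \<in> K" using p_one[of "(g, False)"] g by (simp add: carrier_involution_product)
    qed
    show "K \<subseteq> kernel W Alt \<pi>"
      unfolding K_def using c \<pi>c
      by (intro W.generate_subgroup_incl \<pi>.subgroup_kernel) (simp add: kernel_def)
  qed
  have surj: "\<pi> ` carrier W = carrier Alt"
  proof (rule alternating_group_generated[of _ k n m, folded Alt_def Cox_def, folded a_def b_def])
    show "subgroup (\<pi> ` carrier W) Alt" by (rule \<pi>.img_is_subgroup)
    have "\<pi> (?x 1) = a" using a by (simp add: \<pi>(2) conj_seq_def)
    then show "a \<in> \<pi> ` carrier W" using T.x_closed by (metis imageI)
    \<comment> \<open>The preimage of \<open>b\<close> is \<open>T.t\<close>: its image is
      \<open>b\<close> to the power \<open>m * q\<close>, and \<open>m * q\<close> is 1 modulo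
      \<open>n\<close>, while \<open>b\<close> to the power \<open>n\<close> is trivial.\<close>
    have "\<pi> T.\<delta> = inv\<^bsub>Alt\<^esub> (b [^]\<^bsub>Alt\<^esub> m)"
      by (simp add: T.\<delta>_def \<pi>_run Alt.run_prod_conj_seq_m[OF a b rels])
    then have "\<pi> T.t = b [^]\<^bsub>Alt\<^esub> (m * q)"
      using b by (simp add: T.t_def \<pi>.hom_nat_pow Alt.nat_pow_inv Alt.nat_pow_pow)
    also have "\<dots> = (b [^]\<^bsub>Alt\<^esub> n) [^]\<^bsub>Alt\<^esub> r \<otimes>\<^bsub>Alt\<^esub> b"
      using b qr by (simp add: Alt.nat_pow_pow)
    also have "\<dots> = b" using b rels by simp
    finally show "b \<in> \<pi> ` carrier W" using T.t_closed by (metis imageI)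
  qed

  have incl: "id \<in> mon (W\<lparr>carrier := K\<rparr>) W"
    using K.subset by (auto simp: mon_def hom_def)
  have "group_hom (W\<lparr>carrier := K\<rparr>) W id"
    using W.subgroup_imp_group[OF subK] incl
    by (simp add: group_hom_def group_hom_axioms_def mon_def W.is_group)
  then have "short_exact_sequence Alt W (W\<lparr>carrier := K\<rparr>) \<pi> id"
    using incl \<pi>(1) surj ker
    by (auto simp: short_exact_sequence_iff epi_def intro: Alt.is_group)
  then show ?thesis
    using central unfolding c_eq W_def Alt_def K_def by blast
qed

end
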